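(* Let $q$ be a power of $2$, let $m=4t+2\ge 2$ for an integer $t\ge 0$, and let $n=q^{m}+1$. Then: (1) For every integer $\delta$ with $\delta_{2,n}+1\le\delta\le\delta_{1,n}$, the code $\mathcal{C}_{(n,q,\delta,1)}$ is an LCD code with parameters $[n,5,d\ge\delta_{2,n}]$; for every integer $\delta$ with $\delta_{3,n}+1\le\delta\le\delta_{2,n}$, $\mathcal{C}_{(n,q,\delta,1)}$ is an LCD code with parameters $[n,2m+5,d\ge\delta_{3,n}]$. (2) For every integer $\delta$ with $\delta_{2,n}+1\le\delta\le\delta_{1,n}$, the code $\mathcal{C}_{(n,q,\delta+1,0)}$ is an LCD code with parameters $[n,4,d\ge 2\delta_{2,n}]$; for every integer $\delta$ with $\delta_{3,n}+1\le\delta\le\delta_{2,n}$, $\mathcal{C}_{(n,q,\delta+1,0)}$ is an LCD code with parameters $[n,2m+4,d\ge 2\delta_{3,n}]$.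
   Context: Let $q$ be a prime power and $n\ge2$ an integer with $\gcd(n,q)=1$. Let $\ell=\mathrm{ord}_n(q)$, let $\alpha$ be a generator of $\mathbb{F}_{q^\ell}^*$, $\beta=\alpha^{(q^\ell-1)/n}$, and let $m_i(x)$ be the minimal polynomial of $\beta^i$ over $\mathbb{F}_q$. For integers $b\ge0$ and $2\le\delta\le n$, $\mathcal{C}_{(n,q,\delta,b)}$ denotes the cyclic code of length $n$ over $\mathbb{F}_q$ with generator polynomial $\mathrm{lcm}(m_b(x),m_{b+1}(x),\dots,m_{b+\delta-2}(x))$. A linear code $\mathcal{C}$ is LCD if $\mathcal{C}\cap\mathcal{C}^{\perp}=\{0\}$ ($\perp$ the Euclidean dual). The notation $[n,k,d\ge D]$ means length $n$, dimension $k$, and minimum Hamming distance at least $D$. For $0\le s\le n-1$, the $q$-cyclotomic coset of $s$ modulo $n$ is $C_s=\{sq^i \bmod n:0\le i\le \ell-1\}$; its least element is its coset leader; $\mathrm{MinRep}_n$ is the set of all coset leaders modulo $n$ (including $0$), and $\delta_{i,n}$ denotes the $i$-th largest element of $\mathrm{MinRep}_n$. *)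

theory Defs
  imports "HOL-Computational_Algebra.Computational_Algebra" "HOL-Number_Theory.Pocklington"
begin

(* Polynomials over a field form a vector space under smult; codewords of length n
   are identified with polynomials of degree < n (c_0 + c_1 x + ... + c_{n-1} x^{n-1}). *)
global_interpretation poly_vs: vector_space "Polynomial.smult :: 'a::field \<Rightarrow> 'a poly \<Rightarrow> 'a poly"
  by unfold_locales (simp_all add: smult_add_right smult_add_left)

definition cyc_coset :: "nat \<Rightarrow> nat \<Rightarrow> nat \<Rightarrow> nat set" where
  "cyc_coset q n s = {(s * q ^ i) mod n | i. i < ord n q}"

definition MinRep :: "nat \<Rightarrow> nat \<Rightarrow> nat set" where
  "MinRep q n = {s. s < n \<and> s = Min (cyc_coset q n s)}"

definition delta_rep :: "nat \<Rightarrow> nat \<Rightarrow> nat \<Rightarrow> nat" where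
  "delta_rep q n i = rev (sorted_list_of_set (MinRep q n)) ! (i - 1)"

definition min_poly :: "('a::field \<Rightarrow> 'b::field) \<Rightarrow> 'b \<Rightarrow> 'a poly" where
  "min_poly emb x = (THE p. lead_coeff p = 1 \<and> poly (map_poly emb p) x = 0 \<and>
      (\<forall>r. r \<noteq> 0 \<and> poly (map_poly emb r) x = 0 \<longrightarrow> degree p \<le> degree r))"

definition poly_lcm :: "'a::field poly set \<Rightarrow> 'a poly" where
  "poly_lcm S = (THE g. lead_coeff g = 1 \<and> (\<forall>p\<in>S. p dvd g) \<and>
      (\<forall>h. (\<forall>p\<in>S. p dvd h) \<longrightarrow> g dvd h))"

definition bch_code :: "('a::field \<Rightarrow> 'b::field) \<Rightarrow> 'b \<Rightarrow> nat \<Rightarrow> nat \<Rightarrow> nat \<Rightarrow> 'a poly set" where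
  "bch_code emb \<beta> n \<delta> b =
     (let g = poly_lcm ((\<lambda>i. min_poly emb (\<beta> ^ i)) ` {b..b + \<delta> - 2})
      in {c. degree c < n \<and> g dvd c})"

definition dual_code :: "nat \<Rightarrow> 'a::field poly set \<Rightarrow> 'a poly set" where
  "dual_code n C = {v. degree v < n \<and> (\<forall>c\<in>C. (\<Sum>i<n. Polynomial.coeff v i * Polynomial.coeff c i) = 0)}"

definition is_LCD :: "nat \<Rightarrow> 'a::field poly set \<Rightarrow> bool" where
  "is_LCD n C \<longleftrightarrow> C \<inter> dual_code n C = {0}"

definition hweight :: "'a::zero poly \<Rightarrow> nat" where
  "hweight c = card {i. Polynomial.coeff c i \<noteq> 0}"

definition code_params :: "nat \<Rightarrow> 'a::field poly set \<Rightarrow> nat \<Rightarrow> nat \<Rightarrow> bool" where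
  "code_params n C k D \<longleftrightarrow>
     (\<forall>c\<in>C. degree c < n) \<and> poly_vs.subspace C \<and> poly_vs.dim C = k \<and>
     (\<forall>c\<in>C. c \<noteq> 0 \<longrightarrow> D \<le> hweight c)"

end

theory Submission
  imports Defs
begin

section \<open>Leaders of cyclotomic cosets modulo \<open>q ^ m + 1\<close>\<close>

text \<open>
  Modulo \<open>n = q ^ m + 1\<close> every \<open>q\<close>-cyclotomic coset is closed under negation, so a leader \<open>s\<close> keeps
  distance at least \<open>s\<close> from all multiples of \<open>n\<close> along its orbit.  Write \<open>n = (q\<^sup>2 + 1) N\<close>.  Testing
  this on \<open>s q\<close> and \<open>s q\<^sup>2\<close> gives \<open>s \<le> s\<^sub>1 = N q (q - 1) / 2\<close>, and \<open>s\<^sub>1\<close> is a leader whose coset has four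
  elements.  For a smaller leader \<open>s\<^sub>1 - u\<close>, multiplication by \<open>q ^ 4\<close> fixes \<open>s\<^sub>1\<close>; if \<open>q ^ 4 u < 2 s\<^sub>1\<close>, then
  all \<open>s q ^ (4 k)\<close> have the form \<open>\<plusminus>(s\<^sub>1 - w)\<close> with \<open>0 < w \<le> u\<close>, which contradicts \<open>s q ^ m = - s\<close>.
  For \<open>m \<ge> 6\<close> the least \<open>u\<close> left is \<open>q (q - 1) M\<close> with \<open>(q\<^sup>2 + 1) M = q ^ (m - 4) + 1\<close>; it is attained, by a
  coset of \<open>2 m\<close> elements.  For \<open>m = 2\<close> all nonzero cosets have four elements.

  The dimension of a code is the number of exponents outside its defining set, hence is read off
  from the cosets of the largest leaders.  Since defining sets are closed under negation, the codes
  are LCD, and including the exponent \<open>0\<close> doubles the run of consecutive zeros in the BCH bound.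
\<close>

section \<open>Estimates for leaders in integer arithmetic\<close>

text \<open>Absolute values treat the orbits of \<open>s\<close> and \<open>- s\<close> together,
  and the free \<open>k\<close> allows estimates through any convenient representative instead of
  through \<open>mod\<close>.\<close>

definition int_leader :: "int \<Rightarrow> int \<Rightarrow> int \<Rightarrow> bool" where
  "int_leader q n s \<longleftrightarrow> (\<forall>i k. s \<le> \<bar>s * q ^ i - k * n\<bar>)"

text \<open>With \<open>e = n - 2 * s\<close> the claim reads \<open>e \<ge> (q + 1) * N\<close>.
  Modulo \<open>n\<close>, \<open>s * q\<close> is \<open>- P * e\<close> and
  \<open>s * q ^ 2\<close> is \<open>- P * g\<close> with \<open>g = q * e - n\<close>, so the
  leader condition bounds \<open>e\<close> and the absolute value of \<open>g\<close> from
  below.\<close>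

lemma int_leader_le_first:
  fixes q n N P s :: int
  assumes q: "q = 2 * P" "P \<ge> 1" and n: "n = (q\<^sup>2 + 1) * N" "N > 0" and ndvd: "\<not> (q + 1) dvd n"
    and lead: "int_leader q n s" and s: "s > 0"
  shows "s \<le> P * (q - 1) * N"
proof (rule ccontr)
  assume "\<not> s \<le> P * (q - 1) * N"
  have L: "s \<le> \<bar>s * q ^ i - k * n\<bar>" for i k using lead by (simp add: int_leader_def)
  define e where "e = n - 2 * s"
  have npos: "n > 0" using n by simp
  have "2 * s > q * (q - 1) * N" using \<open>\<not> s \<le> P * (q - 1) * N\<close> q by (simp add: algebra_simps)
  then have e_lt: "e < (q + 1) * N" by (simp add: e_def n algebra_simps power2_eq_square)
  have "s \<le> \<bar>s - n\<bar>" using L[of 0 1] by simp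
  then have e_nonneg: "e \<ge> 0" using npos by (simp add: e_def abs_if split: if_splits)
  have sq: "s * q - P * n = - (P * e)" by (simp add: e_def q algebra_simps)
  have "s \<le> P * e" using L[of 1 P] sq e_nonneg q by simp
  then have lo: "n - e \<le> q * e" using q by (simp add: e_def)
  define g where "g = q * e - n"
  have "s * q ^ 2 - (P * (q - 1)) * n = - (P * g)"
    by (simp add: e_def g_def q algebra_simps power2_eq_square)
  then have "s \<le> \<bar>P * g\<bar>" using L[of 2 "P * (q - 1)"] by simp
  then have qg: "n - e \<le> q * \<bar>g\<bar>" using q by (simp add: e_def abs_mult)
  show False
  proof (cases "g \<ge> 0")
    case True
    then have "n - e \<le> q * (q * e - n)" using qg by (simp add: g_def)
    then have "(q + 1) * n \<le> (q\<^sup>2 + 1) * e" by (simp add: algebra_simps power2_eq_square)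
    then have "(q\<^sup>2 + 1) * ((q + 1) * N) \<le> (q\<^sup>2 + 1) * e" by (simp add: n algebra_simps)
    moreover have "q\<^sup>2 + 1 > 0" by (simp add: add_nonneg_pos)
    ultimately show False using e_lt by simp
  next
    case False
    \<comment> \<open>For negative \<open>g\<close> the two lower bounds meet in
      \<open>n = (q + 1) * e\<close>; the divisibility hypothesis exists to exclude this
      case.\<close>
    then have "n - e \<le> q * (n - q * e)" using qg by (simp add: g_def)
    then have "(q - 1) * ((q + 1) * e) \<le> (q - 1) * n" by (simp add: algebra_simps)
    moreover have "q - 1 > 0" using q by simp
    ultimately have "(q + 1) * e \<le> n" by simp
    moreover have "n \<le> (q + 1) * e" using lo by (simp add: algebra_simps)
    ultimately have "n = (q + 1) * e" by simp
    then show False using ndvd by simp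
  qed
qed

text \<open>Multiplication by \<open>q ^ 4\<close> fixes \<open>s1\<close> modulo \<open>n\<close>
  and scales the defect \<open>u\<close>. A defect below the bound would stay small at all exponents
  divisible by 4; one more factor \<open>q ^ 2\<close> sends \<open>s1\<close> to
  \<open>- s1\<close>, and the result cannot be congruent to \<open>- s\<close>.\<close>

lemma int_leader_gap:
  fixes q n N P s u :: int
  assumes q: "q = 2 * P" "P \<ge> 1" and n: "n = (q\<^sup>2 + 1) * N" "N > 0"
    and lead: "int_leader q n s" and s: "s > 0" "s = P * (q - 1) * N - u" "u > 0"
    and neg: "[s * q ^ (4 * t + 2) = - s] (mod n)"
  shows "q ^ 4 * u \<ge> 2 * (P * (q - 1) * N)"
proof (rule ccontr)
  assume "\<not> q ^ 4 * u \<ge> 2 * (P * (q - 1) * N)"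
  define s1 where "s1 = P * (q - 1) * N"
  have lt: "q ^ 4 * u < 2 * s1" using \<open>\<not> q ^ 4 * u \<ge> 2 * (P * (q - 1) * N)\<close> by (simp add: s1_def)
  have L: "s \<le> \<bar>s * q ^ i - k * n\<bar>" for i k using lead by (simp add: int_leader_def)
  have s1_2: "q\<^sup>2 * s1 = P * (q - 1) * n - s1" by (simp add: s1_def n algebra_simps)
  have s1_4: "q ^ 4 * s1 = (q\<^sup>2 - 1) * (P * (q - 1)) * n + s1"
    by (simp add: s1_def n algebra_simps power2_eq_square power4_eq_xxxx)
  have q2: "q \<ge> 2" using q by simp
  have su: "s1 = s + u" using s by (simp add: s1_def)
  have step: "\<exists>e w j. (e = 1 \<or> e = - 1) \<and> 0 < w \<and> w \<le> u \<and> s * q ^ (4 * k) = e * (s1 - w) + j * n" for k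
  proof (induction k)
    case 0
    show ?case using s by (intro exI[of _ 1] exI[of _ u] exI[of _ 0]) (simp add: s1_def)
  next
    case (Suc k)
    then obtain e w j where IH: "e = 1 \<or> e = - 1" "0 < w" "w \<le> u" "s * q ^ (4 * k) = e * (s1 - w) + j * n"
      by blast
    define j' where "j' = e * (q\<^sup>2 - 1) * (P * (q - 1)) + j * q ^ 4"
    have "s * q ^ (4 * Suc k) = s * q ^ (4 * k) * q ^ 4" by (simp add: power_add)
    also have "\<dots> = e * (q ^ 4 * s1) - e * (q ^ 4 * w) + j * q ^ 4 * n"
      unfolding IH(4) by (simp add: algebra_simps)
    also have "\<dots> = e * (s1 - q ^ 4 * w) + j' * n"
      unfolding s1_4 j'_def by (simp add: algebra_simps)
    finally have eq: "s * q ^ (4 * Suc k) = e * (s1 - q ^ 4 * w) + j' * n" .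
    have "s \<le> \<bar>s * q ^ (4 * Suc k) - j' * n\<bar>" by (rule L)
    also have "\<dots> = \<bar>s1 - q ^ 4 * w\<bar>" unfolding eq using IH(1) by (auto simp: abs_minus_commute)
    finally have ge: "s \<le> \<bar>s1 - q ^ 4 * w\<bar>" .
    have q4: "q ^ 4 \<ge> 16" using power_mono[OF q2, of 4] by simp
    have "q ^ 4 * w \<le> q ^ 4 * u" using IH(3) q4 by (intro mult_left_mono) simp_all
    then have up: "q ^ 4 * w < 2 * s1" using lt by simp
    show ?case
    proof (cases "q ^ 4 * w \<le> u")
      case True
      moreover have "0 < q ^ 4 * w" using IH(2) q2 by (intro mult_pos_pos) simp_all
      ultimately show ?thesis using eq IH(1) by blast
    next
      case False
      \<comment> \<open>Changing the sign of \<open>s1 - q ^ 4 * w\<close> replaces the defect by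
        \<open>2 * s1 - q ^ 4 * w\<close>: positive by the assumed bound on
        \<open>q ^ 4 * u\<close>, and at most \<open>u\<close> by the leader condition.\<close>
      then have "s \<le> q ^ 4 * w - s1" using ge su by (simp add: abs_if split: if_splits)
      then have "0 < 2 * s1 - q ^ 4 * w" "2 * s1 - q ^ 4 * w \<le> u" using su up by simp_all
      moreover have "s * q ^ (4 * Suc k) = - e * (s1 - (2 * s1 - q ^ 4 * w)) + j' * n"
        using eq by (simp add: algebra_simps)
      moreover have "- e = 1 \<or> - e = - 1" using IH by auto
      ultimately show ?thesis by blast
    qed
  qed
  obtain e w j where ew: "e = 1 \<or> e = - 1" "0 < w" "w \<le> u" "s * q ^ (4 * t) = e * (s1 - w) + j * n"
    using step by blast
  have "s * q ^ (4 * t + 2) = (s * q ^ (4 * t)) * q\<^sup>2" by (simp add: power_add power2_eq_square)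
  also have "\<dots> = e * (q\<^sup>2 * s1) - e * (q\<^sup>2 * w) + j * q\<^sup>2 * n"
    unfolding ew(4) by (simp add: algebra_simps)
  also have "\<dots> = - e * (s1 + q\<^sup>2 * w) + (e * (P * (q - 1)) + j * q\<^sup>2) * n"
    unfolding s1_2 by (simp add: algebra_simps)
  finally have "[s * q ^ (4 * t + 2) = - e * (s1 + q\<^sup>2 * w)] (mod n)"
    by (simp add: cong_iff_dvd_diff)
  then have "[- s = - e * (s1 + q\<^sup>2 * w)] (mod n)"
    using neg by (metis cong_sym cong_trans)
  then have dvd: "n dvd e * (s1 + q\<^sup>2 * w) - s"
    by (simp add: cong_iff_dvd_diff algebra_simps)
  have q4: "q ^ 4 = q\<^sup>2 * q\<^sup>2" by (simp add: power4_eq_xxxx power2_eq_square)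
  have q22: "q\<^sup>2 \<ge> 4" using power_mono[OF q2, of 2] by simp
  \<comment> \<open>The corrections \<open>u\<close> and \<open>q ^ 2 * w\<close> are thus each
    below \<open>N\<close>, while \<open>n\<close> exceeds \<open>2 * s1\<close> by
    \<open>(q + 1) * N\<close>; for neither sign is there room for a positive multiple of
    \<open>n\<close>.\<close>
  have small: "q\<^sup>2 * u < N"
  proof -
    have "q\<^sup>2 * (q\<^sup>2 * u) < 2 * s1" using lt unfolding q4 by (simp only: mult.assoc)
    also have "\<dots> = q * (q - 1) * N" unfolding s1_def q(1) by simp
    also have "\<dots> \<le> q\<^sup>2 * N" unfolding power2_eq_square using q2 n(2) by (intro mult_right_mono mult_left_mono) simp_all
    finally show ?thesis using q22 by (simp only: mult_less_cancel_left_disj) linarith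
  qed
  have w_le: "q\<^sup>2 * w \<le> q\<^sup>2 * u" "0 < q\<^sup>2 * w" using ew(2,3) q2 by (auto intro: mult_left_mono mult_pos_pos)
  have u_le: "u \<le> q\<^sup>2 * u" using mult_right_mono[of 1 "q\<^sup>2" u] s(3) q22 by simp
  have ns1: "2 * s1 + (q + 1) * N = n" by (simp add: s1_def n q algebra_simps power2_eq_square)
  have N3: "3 * N \<le> (q + 1) * N" using q2 n(2) by (intro mult_right_mono) simp_all
  have s1pos: "s1 > 0" using su s(1,3) by linarith
  from ew(1) show False
  proof
    assume "e = 1"
    then have "n dvd u + q\<^sup>2 * w" using dvd su by (simp add: algebra_simps)
    then have "n \<le> u + q\<^sup>2 * w" using w_le(2) s(3) by (intro zdvd_imp_le) simp_all
    then show False using small w_le u_le ns1 N3 s1pos by linarith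
  next
    assume "e = - 1"
    then have "n dvd - (2 * s1 - u + q\<^sup>2 * w)" using dvd su by (simp add: algebra_simps)
    then have "n dvd 2 * s1 - u + q\<^sup>2 * w" by (simp only: dvd_minus_iff)
    moreover have "2 * s1 - u + q\<^sup>2 * w > 0" using su s(1,3) w_le by linarith
    ultimately have "n \<le> 2 * s1 - u + q\<^sup>2 * w" by (rule zdvd_imp_le)
    then show False using small w_le u_le ns1 N3 s1pos s(1,3) n(2) by linarith
  qed
qed

text \<open>The exponents 1, 2 and 3 are treated directly. From 4 on, the orbit of \<open>s2\<close>
  follows that of \<open>s1\<close> up to sign, with a perturbation that starts at \<open>w\<close>
  and is multiplied by \<open>q\<close> at each step; it stays within the permitted range until the
  orbit reaches \<open>- s2\<close>.\<close>

lemma second_leader_residues: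
  fixes q n N M P s1 s2 :: int
  assumes q: "q = 2 * P" "P \<ge> 1" and n: "n = (q\<^sup>2 + 1) * N" and N: "N = q ^ 4 * M - q\<^sup>2 + 1"
    and M: "M \<ge> 1" "(q\<^sup>2 + 1) * M = q ^ (4 * t + 2) + 1"
    and s: "s1 = P * (q - 1) * N" "s2 = s1 - q * (q - 1) * M"
    and i: "0 < i" "i < 4 * Suc t + 2"
  shows "\<exists>e r. (e = 1 \<or> e = - 1) \<and> s2 < r \<and> r < n - s2 \<and> [s2 * q ^ i = e * r] (mod n)"
proof -
  have q2: "q \<ge> 2" using q by simp
  define H where "H = P * (q - 1)"
  have H2: "2 * H = q * (q - 1)" by (simp add: H_def q)
  define u where "u = q * (q - 1) * M"
  \<comment> \<open>\<open>b\<close> will be the residue of \<open>q * s1\<close>, and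
    \<open>w\<close> the excess of \<open>q ^ 4 * u\<close> over \<open>2 * s1\<close>.\<close>
  define b where "b = (H + 1) * N"
  define w where "w = q * (q - 1) * (q\<^sup>2 - 1)"
  have s2u: "s2 = s1 - u" by (simp add: s u_def)
  have goodI: ?thesis if "[s2 * q ^ i = e * r] (mod n)" "e = 1 \<or> e = - 1" "s1 - u < r" "r < n - s1 + u" for e r
    using that by (intro exI[of _ e] exI[of _ r]) (simp add: s2u)
  have upos: "u > 0" using q2 M by (simp add: u_def)
  have q4: "q ^ 4 = q * q * q * q" and qsq: "q\<^sup>2 = q * q"
    by (simp_all add: power4_eq_xxxx power2_eq_square)
  have q3N: "q ^ 3 * u = (q - 1) * (N + q\<^sup>2 - 1)"
    by (simp add: N u_def q4 qsq power3_eq_cube algebra_simps)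
  have q4u: "q ^ 4 * u = 2 * s1 + w"
    using H2 by (simp add: N u_def s w_def q4 qsq q algebra_simps)
  have s1H: "s1 = H * N" by (simp add: s H_def)
  have qs1: "q * s1 = (P - 1) * n + b"
    by (simp add: b_def n H_def s q algebra_simps power2_eq_square)
  have q2s1: "q\<^sup>2 * s1 = H * n - s1"
    by (simp add: n H_def s algebra_simps power2_eq_square)
  have qq: "q * q \<ge> 2 * q" "q * q * q \<ge> 2 * (q * q)" "q * q * q * q \<ge> 2 * (q * q * q)"
    using q2 by simp_all
  have Npos: "N > (q - 1) * u"
  proof -
    have nonneg: "q * q \<le> q * q * q * q - q * (q - 1) * (q - 1)"
      using qq q2 by (simp only: algebra_simps mult_1_right)
    then have "q * q \<le> (q * q * q * q - q * (q - 1) * (q - 1)) * 1"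
      using nonneg by simp
    also have "\<dots> \<le> (q * q * q * q - q * (q - 1) * (q - 1)) * M"
      using M(1) by (intro mult_left_mono order_trans[OF _ nonneg]) simp_all
    finally show ?thesis by (simp add: N u_def q4 qsq algebra_simps)
  qed
  have N_big: "N > (q - 1) * (q\<^sup>2 - 1)"
  proof -
    have "q ^ 4 * 1 \<le> q ^ 4 * M" using M q2 by (intro mult_left_mono) simp_all
    then show ?thesis unfolding N q4 qsq using qq q2 by (simp only: algebra_simps mult_1_right)
  qed
  have gap: "n - s1 = s1 + q * N + N" "n - s1 = b + q * N"
    using arg_cong[OF H2, of "\<lambda>x. x * N"]
    by (simp_all add: n s1H b_def algebra_simps power2_eq_square)
  have bs1: "b = s1 + N" by (simp add: b_def s1H algebra_simps)
  have qu_N: "q * u - u < N" using Npos by (simp add: algebra_simps)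
  have Npos0: "N > 0" using Npos upos q2 by (smt (verit) mult_nonneg_nonneg)
  have qN: "2 * N \<le> q * N" using q2 Npos0 by simp
  \<comment> \<open>Each further factor \<open>q ^ 2\<close> flips the sign of \<open>s1\<close> but
    not that of the perturbation, so the perturbation alternately enlarges and diminishes the
    absolute representative.\<close>
  have far: "\<exists>k. s2 * q ^ (4 + 2 * j) = (- 1) ^ Suc j * s1 - w * q ^ (2 * j) + k * n" for j
  proof (induction j)
    case 0
    have "s2 * q ^ 4 = q\<^sup>2 * (q\<^sup>2 * s1) - q ^ 4 * u" by (simp add: s2u qsq q4 algebra_simps)
    also have "\<dots> = q\<^sup>2 * (H * n - s1) - (2 * s1 + w)" by (simp only: q2s1 q4u)
    also have "\<dots> = - s1 - w + (q\<^sup>2 * H - H) * n"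
      using q2s1 by (simp add: algebra_simps)
    finally show ?case by auto
  next
    case (Suc j)
    then obtain k where k: "s2 * q ^ (4 + 2 * j) = (- 1) ^ Suc j * s1 - w * q ^ (2 * j) + k * n" by blast
    have "s2 * q ^ (4 + 2 * Suc j) = s2 * q ^ (4 + 2 * j) * q\<^sup>2"
      by (simp add: mult.assoc flip: power_add)
    also have "\<dots> = (- 1) ^ Suc j * (q\<^sup>2 * s1) - w * (q ^ (2 * j) * q\<^sup>2) + k * q\<^sup>2 * n"
      unfolding k by (simp add: algebra_simps)
    also have "\<dots> = (- 1) ^ Suc (Suc j) * s1 - w * q ^ (2 * Suc j) + ((- 1) ^ Suc j * H + k * q\<^sup>2) * n"
      unfolding q2s1 by (simp add: algebra_simps power2_eq_square)
    finally show ?case by blast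
  qed
  have far_odd: "\<exists>k. s2 * q ^ (5 + 2 * j) = (- 1) ^ Suc j * b - w * q ^ (2 * j) * q + k * n" for j
  proof -
    obtain k where k: "s2 * q ^ (4 + 2 * j) = (- 1) ^ Suc j * s1 - w * q ^ (2 * j) + k * n"
      using far by blast
    have "s2 * q ^ (5 + 2 * j) = s2 * q ^ (4 + 2 * j) * q" by (simp add: mult.assoc flip: power_Suc2)
    also have "\<dots> = (- 1) ^ Suc j * (q * s1) - w * q ^ (2 * j) * q + k * q * n"
      unfolding k by (simp add: algebra_simps)
    also have "\<dots> = (- 1) ^ Suc j * b - w * q ^ (2 * j) * q + ((- 1) ^ Suc j * (P - 1) + k * q) * n"
      unfolding qs1 by (simp add: algebra_simps)
    finally show ?thesis by blast
  qed
  have q2m1: "q\<^sup>2 - 1 > 0" using qq(1) q2 unfolding qsq by linarith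
  have wpos: "w > 0" unfolding w_def using q2 q2m1 by (intro mult_pos_pos) simp_all
  have wy_pos: "0 < w * q ^ (2 * j)" for j using wpos q2 by simp
  have wy_N: "w * q ^ (2 * j) < N" if "j \<le> 2 * t" for j
  proof -
    define y where "y = q ^ (2 * j)"
    have "q\<^sup>2 * y = q ^ (2 * j + 2)" by (simp add: y_def power_add power2_eq_square)
    also have "\<dots> \<le> q ^ (4 * t + 2)" using that q2 by (intro power_increasing) simp_all
    also have "\<dots> < (q\<^sup>2 + 1) * M" using M by simp
    finally have y: "q\<^sup>2 * y < (q\<^sup>2 + 1) * M" .
    have pos: "(q - 1) * (q\<^sup>2 - 1) > 0" using q2 q2m1 by (intro mult_pos_pos) simp_all
    have "q * (w * y) = (q - 1) * (q\<^sup>2 - 1) * (q\<^sup>2 * y)" by (simp add: w_def qsq algebra_simps)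
    also have "\<dots> \<le> (q - 1) * (q\<^sup>2 - 1) * ((q\<^sup>2 + 1) * M)" using y pos by (intro mult_left_mono) simp_all
    also have "\<dots> < q * N"
    proof -
      have "0 < q * q * q * q + q" using q2 by (intro add_pos_pos mult_pos_pos) simp_all
      have "q * q * q * 1 \<le> (q * q * q * q + q - 1) * 1"
        using qq q2 by (simp only: algebra_simps mult_1_right)
      also have "\<dots> \<le> (q * q * q * q + q - 1) * M"
        using M(1) \<open>0 < q * q * q * q + q\<close> by (intro mult_left_mono) simp_all
      finally show ?thesis using q2 by (simp add: N qsq q4 algebra_simps)
    qed
    finally show ?thesis using q2 by (simp add: y_def)
  qed
  \<comment> \<open>This sharper bound serves odd \<open>j\<close>, where
    \<open>s1 - w * q ^ (2 * j)\<close> has to stay above \<open>s2 = s1 - u\<close>.\<close>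
  have wy_u: "w * q ^ (2 * j) < u" if "j < 2 * t" for j
  proof -
    define y where "y = q ^ (2 * j)"
    have y0: "y > 0" using q2 by (simp add: y_def)
    have "q ^ 4 * y = q ^ (2 * j + 4)" by (simp add: y_def power_add)
    also have "\<dots> \<le> q ^ (4 * t + 2)" using that q2 by (intro power_increasing) simp_all
    also have "\<dots> < (q\<^sup>2 + 1) * M" using M by simp
    finally have "(q\<^sup>2 + 1) * ((q\<^sup>2 - 1) * y) < (q\<^sup>2 + 1) * M"
      using y0 by (simp add: q4 qsq algebra_simps)
    moreover have "q\<^sup>2 + 1 > 0" by (simp add: add_nonneg_pos)
    ultimately have "(q\<^sup>2 - 1) * y < M" by simp
    then have "q * (q - 1) * ((q\<^sup>2 - 1) * y) < q * (q - 1) * M"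
      using q2 by (intro mult_strict_left_mono) simp_all
    then show ?thesis by (simp add: w_def u_def y_def mult_ac)
  qed
  consider "i = 1" | "i = 2" | "i = 3" | j where "i = 4 + 2 * j" | j where "i = 5 + 2 * j"
  proof -
    have "i = 1 \<or> i = 2 \<or> i = 3 \<or> i = 4 + 2 * ((i - 4) div 2) \<or> i = 5 + 2 * ((i - 5) div 2)"
      using i(1) by presburger
    then show thesis using that by blast
  qed
  then show ?thesis
  proof cases
    case 1
    have "s2 * q = (P - 1) * n + (b - q * u)"
      using qs1 by (simp add: s2u algebra_simps)
    then have cong: "[s2 * q ^ i = 1 * (b - q * u)] (mod n)"
      using 1 by (simp add: cong_iff_dvd_diff)
    have "0 < q * u" using q2 upos by simp
    then have "s1 - u < b - q * u" "b - q * u < n - s1 + u"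
      using qu_N Npos0 bs1 gap qN upos by linarith+
    then show ?thesis by (intro goodI[OF cong]) simp_all
  next
    case 2
    have "s2 * q\<^sup>2 = H * n - (s1 + q\<^sup>2 * u)"
      using q2s1 by (simp add: s2u algebra_simps)
    then have cong: "[s2 * q ^ i = - 1 * (s1 + q\<^sup>2 * u)] (mod n)"
      using 2 by (simp add: cong_iff_dvd_diff)
    have "0 < q\<^sup>2 * u" using q2 upos by simp
    moreover have "(q + 1) * ((q - 1) * u) < (q + 1) * N" using Npos q2 by simp
    then have "q\<^sup>2 * u - u < q * N + N" by (simp add: algebra_simps power2_eq_square)
    ultimately have "s1 - u < s1 + q\<^sup>2 * u" "s1 + q\<^sup>2 * u < n - s1 + u"
      using gap upos by linarith+
    then show ?thesis by (intro goodI[OF cong]) simp_all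
  next
    case 3
    have "s2 * q ^ 3 = q * (q\<^sup>2 * s1 - q\<^sup>2 * u)"
      by (simp add: s2u power3_eq_cube qsq algebra_simps)
    also have "\<dots> = H * q * n - q * s1 - q ^ 3 * u"
      unfolding q2s1 by (simp add: power3_eq_cube qsq algebra_simps)
    also have "\<dots> = (H * q - (P - 1)) * n - (b + q ^ 3 * u)"
      unfolding qs1 by (simp add: algebra_simps)
    finally have cong: "[s2 * q ^ i = - 1 * (b + q ^ 3 * u)] (mod n)"
      using 3 by (simp add: cong_iff_dvd_diff)
    have "0 < q ^ 3 * u" using q2 upos by simp
    moreover have "q ^ 3 * u < q * N + u" using q3N N_big upos by (simp add: algebra_simps)
    ultimately have "s1 - u < b + q ^ 3 * u" "b + q ^ 3 * u < n - s1 + u"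
      using gap upos bs1 Npos0 by linarith+
    then show ?thesis by (intro goodI[OF cong]) simp_all
  next
    case (4 j)
    obtain k where k: "s2 * q ^ i = (- 1) ^ Suc j * s1 - w * q ^ (2 * j) + k * n"
      using far[of j] 4 by auto
    have j: "j \<le> 2 * t" using 4 i by simp
    show ?thesis
    proof (cases "even j")
      case True
      then have cong: "[s2 * q ^ i = - 1 * (s1 + w * q ^ (2 * j))] (mod n)"
        using k by (simp add: cong_iff_dvd_diff)
      have "s1 - u < s1 + w * q ^ (2 * j)" "s1 + w * q ^ (2 * j) < n - s1 + u"
        using wy_N[OF j] wy_pos[of j] gap upos qN Npos0 by linarith+
      then show ?thesis by (intro goodI[OF cong]) simp_all
    next
      case False
      \<comment> \<open>An odd \<open>j\<close> cannot be the even number \<open>2 * t\<close>, so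
        the largest index falls under the other case, where the weaker bound \<open>wy_N\<close>
        suffices.\<close>
      then have "j < 2 * t" using j by (metis dvd_triv_left le_neq_implies_less)
      note wy = wy_u[OF this]
      have cong: "[s2 * q ^ i = 1 * (s1 - w * q ^ (2 * j))] (mod n)"
        using k False by (simp add: cong_iff_dvd_diff)
      have "s1 - u < s1 - w * q ^ (2 * j)" "s1 - w * q ^ (2 * j) < n - s1 + u"
        using wy wy_pos[of j] gap upos qN Npos0 by linarith+
      then show ?thesis by (intro goodI[OF cong]) simp_all
    qed
  next
    case (5 j)
    obtain k where k: "s2 * q ^ i = (- 1) ^ Suc j * b - w * q ^ (2 * j) * q + k * n"
      using far_odd[of j] 5 by auto
    have j: "j \<le> 2 * t" using 5 i by simp
    have pos: "0 < w * q ^ (2 * j) * q" using wy_pos[of j] q2 by simp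
    show ?thesis
    proof (cases "even j")
      case True
      then have cong: "[s2 * q ^ i = - 1 * (b + w * q ^ (2 * j) * q)] (mod n)"
        using k by (simp add: cong_iff_dvd_diff)
      have "w * q ^ (2 * j) * q < N * q" using wy_N[OF j] q2 by simp
      then have "w * q ^ (2 * j) * q < q * N" by (simp only: mult.commute)
      then have "s1 - u < b + w * q ^ (2 * j) * q" "b + w * q ^ (2 * j) * q < n - s1 + u"
        using pos gap upos bs1 Npos0 by linarith+
      then show ?thesis by (intro goodI[OF cong]) simp_all
    next
      case False
      then have "j < 2 * t" using j by (metis dvd_triv_left le_neq_implies_less)
      then have "w * q ^ (2 * j) * q < u * q" using wy_u q2 by simp
      moreover have "u * q < N + u" using Npos by (simp add: algebra_simps)
      ultimately have "s1 - u < b - w * q ^ (2 * j) * q" "b - w * q ^ (2 * j) * q < n - s1 + u"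
        using pos gap upos qN Npos0 bs1 by linarith+
      moreover have cong: "[s2 * q ^ i = 1 * (b - w * q ^ (2 * j) * q)] (mod n)"
        using k False by (simp add: cong_iff_dvd_diff)
      ultimately show ?thesis by (intro goodI[OF cong]) simp_all
    qed
  qed
qed

section \<open>Powers of \<open>q\<close> modulo \<open>q ^ m + 1\<close>, and a criterion for
  leaders\<close>

locale antipodal_modulus =
  fixes q m n :: nat
  assumes q_even: "even q" and q_ge2: "q \<ge> 2" and m_pos: "m > 0" and n_def: "n = q ^ m + 1"
begin

lemma n_gt_2: "n > 2"
proof -
  have "q ^ 1 \<le> q ^ m" using q_ge2 m_pos by (intro power_increasing) auto
  then show ?thesis using q_ge2 by (simp add: n_def)
qed

lemma odd_n: "odd n"
  using q_even m_pos by (simp add: n_def)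

lemma coprime_q_n: "coprime q n"
proof -
  have "coprime (q ^ m) (q ^ m + 1)" by simp
  then show ?thesis using m_pos unfolding n_def by (simp only: coprime_power_left_iff) simp
qed

lemma q_pow_m: "[int q ^ m = - 1] (mod int n)"
  by (simp add: n_def cong_iff_dvd_diff add.commute)

lemma q_pow_2m: "[q ^ (2 * m) = 1] (mod n)"
proof -
  have "[(int q ^ m) ^ 2 = (- 1) ^ 2] (mod int n)" by (rule cong_pow[OF q_pow_m])
  then have "[int (q ^ (2 * m)) = int 1] (mod int n)" by (simp add: power_mult mult.commute flip: power_mult)
  then show ?thesis using cong_int_iff by blast
qed

text \<open>Powers up to \<open>q ^ m\<close> stay below \<open>n\<close>, so none of positive
  exponent is 1 modulo \<open>n\<close>; a divisor of \<open>2 * m\<close> that exceeds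
  \<open>m\<close> is \<open>2 * m\<close>.\<close>

lemma ord_eq: "ord n q = 2 * m"
proof -
  have dvd: "ord n q dvd 2 * m" using q_pow_2m ord_divides by blast
  have pos: "ord n q > 0" using dvd m_pos by (metis dvd_0_left_iff gr0I mult_is_0 zero_neq_numeral less_irrefl)
  have "\<not> ord n q \<le> m"
  proof
    assume "ord n q \<le> m"
    then have "q ^ ord n q \<le> q ^ m" using q_ge2 by (intro power_increasing) auto
    then have "q ^ ord n q mod n = q ^ ord n q" by (simp add: n_def)
    moreover have "[q ^ ord n q = 1] (mod n)" by (rule ord)
    ultimately have "q ^ ord n q = 1" using n_gt_2 by (simp add: cong_def)
    then show False using pos q_ge2 by simp
  qed
  then have "m < ord n q" by simp
  moreover obtain k where k: "2 * m = ord n q * k" using dvd by auto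
  ultimately have "ord n q * k < ord n q * 2" by linarith
  then have "k < 2" by (rule mult_less_cancel1[THEN iffD1, THEN conjunct2])
  moreover have "k \<noteq> 0" by (rule notI) (use k m_pos in simp)
  ultimately have "k = 1" by simp
  then show ?thesis using k by simp
qed

lemma mod_period: "s * q ^ i mod n = s * q ^ (i mod (2 * m)) mod n"
proof -
  have "[q ^ (2 * m * (i div (2 * m))) = 1 ^ (i div (2 * m))] (mod n)"
    unfolding power_mult by (rule cong_pow) (use q_pow_2m in \<open>simp add: power_mult\<close>)
  then have "[s * (q ^ (2 * m * (i div (2 * m))) * q ^ (i mod (2 * m))) = s * (1 * q ^ (i mod (2 * m)))] (mod n)"
    by (intro cong_scalar_left cong_scalar_right) simp
  then show ?thesis by (simp add: cong_def flip: power_add)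
qed

lemma cyc_coset_eq: "cyc_coset q n s = range (\<lambda>i. s * q ^ i mod n)"
proof -
  have "s * q ^ i mod n \<in> cyc_coset q n s" for i
    using mod_period[of s i] m_pos unfolding cyc_coset_def ord_eq
    by (auto intro!: exI[of _ "i mod (2 * m)"])
  then show ?thesis by (auto simp: cyc_coset_def)
qed

lemma finite_cyc_coset: "finite (cyc_coset q n s)"
  by (simp add: cyc_coset_def)

lemma mem_cyc_coset_self: "s < n \<Longrightarrow> s \<in> cyc_coset q n s"
  unfolding cyc_coset_eq by (rule range_eqI[of _ _ 0]) simp

lemma MinRep_iff: "s \<in> MinRep q n \<longleftrightarrow> s < n \<and> (\<forall>i. s \<le> s * q ^ i mod n)"
proof (cases "s < n")
  case True
  have "s = Min (cyc_coset q n s) \<longleftrightarrow> (\<forall>x\<in>cyc_coset q n s. s \<le> x)"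
    using Min_eq_iff[OF finite_cyc_coset] mem_cyc_coset_self[OF True] by (metis empty_iff)
  then show ?thesis using True by (auto simp: MinRep_def cyc_coset_eq)
qed (simp add: MinRep_def)

lemma neg_residue: "[int (s * q ^ (i + m) mod n) = - int (s * q ^ i)] (mod int n)"
proof -
  have "[int s * int q ^ i * int q ^ m = int s * int q ^ i * (- 1)] (mod int n)"
    by (rule cong_scalar_left[OF q_pow_m])
  then show ?thesis by (simp add: power_add mult_ac zmod_int)
qed

text \<open>A nonnegative difference is at least its residue, which lies in the coset. For a
  negative one, moving \<open>m\<close> steps further along the orbit negates it and reduces to the
  same argument.\<close>

lemma MinRep_imp_int_leader:
  assumes "s \<in> MinRep q n"
  shows "int_leader (int q) (int n) (int s)"
  unfolding int_leader_def
proof (intro allI)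
  fix i :: nat and k :: int
  have min: "s \<le> s * q ^ i mod n" for i using assms by (simp add: MinRep_iff)
  let ?x = "int s * int q ^ i - k * int n"
  have mod_le: "y mod int n \<le> y" if "y \<ge> 0" for y using that by (simp add: zmod_le_nonneg_dividend)
  show "int s \<le> \<bar>?x\<bar>"
  proof (cases "?x \<ge> 0")
    case True
    have "int s \<le> int (s * q ^ i mod n)" using min by simp
    also have "\<dots> = ?x mod int n"
      by (simp add: zmod_int flip: cong_def) (simp add: cong_iff_dvd_diff)
    also have "\<dots> \<le> ?x" using True by (rule mod_le)
    finally show ?thesis using True by simp
  next
    case False
    have "[- int (s * q ^ i) = - ?x] (mod int n)" by (simp add: cong_iff_dvd_diff)
    then have "[int (s * q ^ (i + m) mod n) = - ?x] (mod int n)" by (rule cong_trans[OF neg_residue])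
    then have "int (s * q ^ (i + m) mod n) = (- ?x) mod int n"
      by (simp add: cong_def flip: zmod_int)
    also have "\<dots> \<le> - ?x" using False by (intro mod_le) simp
    finally show ?thesis using min[of "i + m"] False by simp
  qed
qed

text \<open>If \<open>q ^ p\<close> negates \<open>s\<close>, the orbit is a block of
  \<open>p\<close> residues followed by their negatives, so only the block has to be inspected. Its
  strict bounds give minimality and also exclude an early return. The criterion serves for
  \<open>p = 2\<close> and for \<open>p = m\<close>.\<close>

lemma leaderI:
  assumes s: "0 < s" "2 * s < n" and p: "0 < p" and neg: "[int s * int q ^ p = - int s] (mod int n)"
    and inner: "\<And>i. 0 < i \<Longrightarrow> i < p \<Longrightarrow> \<exists>e r. (e = 1 \<or> e = - 1) \<and> int s < r \<and> r < int n - int s \<and>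
        [int s * int q ^ i = e * r] (mod int n)"
  shows "s \<in> MinRep q n" "card (cyc_coset q n s) = 2 * p"
proof -
  have block: "[int s * int q ^ i = (- 1) ^ (i div p) * (int s * int q ^ (i mod p))] (mod int n)" for i
  proof -
    have mult: "[int s * int q ^ (p * a) = (- 1) ^ a * int s] (mod int n)" for a
    proof (induction a)
      case (Suc a)
      have "[int s * int q ^ (p * a) * int q ^ p = (- 1) ^ a * int s * int q ^ p] (mod int n)"
        using Suc by (rule cong_scalar_right)
      also have "(- 1) ^ a * int s * int q ^ p = (- 1) ^ a * (int s * int q ^ p)" by simp
      also have "[\<dots> = (- 1) ^ a * (- int s)] (mod int n)" using neg by (rule cong_scalar_left)
      also have "int s * int q ^ (p * a) * int q ^ p = int s * int q ^ (p * Suc a)"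
        by (simp add: power_add)
      finally show ?case by simp
    qed simp
    have "[int s * int q ^ (p * (i div p)) * int q ^ (i mod p) = (- 1) ^ (i div p) * int s * int q ^ (i mod p)] (mod int n)"
      by (rule cong_scalar_right[OF mult])
    moreover have "int q ^ (p * (i div p)) * int q ^ (i mod p) = int q ^ i"
      by (simp flip: power_add)
    ultimately show ?thesis by (simp add: mult.assoc)
  qed
  have between: "a \<le> int (x mod n)" if "[int x = e * r] (mod int n)" "e = 1 \<or> e = - 1" "a \<le> r" "r \<le> int n - a" "0 < a"
    for x e r and a :: int
  proof -
    have "int (x mod n) = (e * r) mod int n" using that(1) by (simp add: cong_def zmod_int)
    moreover have "r mod int n = r" using that by (intro mod_pos_pos_trivial) auto
    moreover have "(- r) mod int n = int n - r"
      using that by (simp add: zmod_zminus1_eq_if \<open>r mod int n = r\<close>)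
    ultimately show ?thesis using that by auto
  qed
  have sign: "(- 1) ^ a = (1::int) \<or> (- 1) ^ a = (- 1::int)" for a :: nat
    by (cases "even a") auto
  have strict: "s < s * q ^ i mod n" if pos: "i mod p > 0" for i
  proof -
    obtain e r where er: "e = 1 \<or> e = - 1" "int s < r" "r < int n - int s"
        "[int s * int q ^ (i mod p) = e * r] (mod int n)"
      using inner[OF pos mod_less_divisor[OF p]] by blast
    have "[int s * int q ^ i = (- 1) ^ (i div p) * (e * r)] (mod int n)"
      by (rule cong_trans[OF block cong_scalar_left[OF er(4)]])
    then have cg: "[int (s * q ^ i) = ((- 1) ^ (i div p) * e) * r] (mod int n)" by (simp add: mult.assoc)
    have "int s + 1 \<le> int (s * q ^ i mod n)"
      using er sign[of "i div p"] by (intro between[OF cg]) auto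
    then show ?thesis by simp
  qed
  have weak: "s \<le> s * q ^ i mod n" for i
  proof (cases "i mod p = 0")
    case True
    then have cg: "[int (s * q ^ i) = (- 1) ^ (i div p) * int s] (mod int n)" using block[of i] by simp
    have "int s \<le> int (s * q ^ i mod n)" using sign s by (intro between[OF cg]) auto
    then show ?thesis by simp
  qed (use strict less_imp_le in auto)
  then show "s \<in> MinRep q n" using s by (simp add: MinRep_iff)
  \<comment> \<open>A collision at distance \<open>d < 2 * p\<close> returns \<open>s\<close> to
    itself. Strictness forces \<open>p\<close> to divide \<open>d\<close>, hence
    \<open>d = p\<close>; but there \<open>s\<close> is negated, and
    \<open>0 < 2 * s < n\<close>.\<close>
  have distinct: False if "i < j" "j < 2 * p" "s * q ^ i mod n = s * q ^ j mod n" for i j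
  proof -
    define d where "d = j - i"
    have d: "0 < d" "d < 2 * p" using that by (auto simp: d_def)
    have "[s * q ^ d * q ^ i = s * q ^ i] (mod n)"
      using that by (simp add: d_def cong_def mult.assoc flip: power_add)
    moreover have "coprime (q ^ i) n" using coprime_q_n by simp
    ultimately have sd: "[s * q ^ d = s] (mod n)" using cong_mult_rcancel_nat by blast
    then have "s * q ^ d mod n = s" using s by (simp add: cong_def)
    then have "d mod p = 0" using strict[of d] by (metis gr0I less_irrefl)
    then obtain a where a: "d = p * a" by auto
    then have "a < 2" "a \<noteq> 0" using d by auto
    then have "d = p" using a by (simp add: less_2_cases_iff)
    then have "[int s * int q ^ p = int s] (mod int n)" using sd
      by (simp flip: cong_int_iff)
    then have "[- int s = int s] (mod int n)" by (rule cong_trans[OF cong_sym[OF neg]])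
    then have "int n dvd 2 * int s" by (simp add: cong_iff_dvd_diff)
    then show False using s zdvd_imp_le[of "int n" "2 * int s"] by simp
  qed
  have "cyc_coset q n s = (\<lambda>i. s * q ^ i mod n) ` {..<2 * p}"
  proof -
    have "s * q ^ i mod n = s * q ^ (i mod (2 * p)) mod n" for i
    proof -
      have "i mod (2 * p) mod p = i mod p" by (simp add: mod_mod_cancel)
      moreover have "even (i div p) = even (i mod (2 * p) div p)"
        unfolding mult.commute[of 2 p] mod_mult2_eq using p by simp
      ultimately have "[int s * int q ^ (i mod (2 * p)) = (- 1) ^ (i div p) * (int s * int q ^ (i mod p))] (mod int n)"
        using block[of "i mod (2 * p)"] by (cases "even (i div p)") auto
      then have "[int (s * q ^ i) = int (s * q ^ (i mod (2 * p)))] (mod int n)"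
        using cong_trans[OF block[of i] cong_sym] by simp
      then show ?thesis unfolding cong_int_iff by (simp only: cong_def)
    qed
    then have "s * q ^ i mod n \<in> (\<lambda>i. s * q ^ i mod n) ` {..<2 * p}" for i
      using p by (intro image_eqI[of _ _ "i mod (2 * p)"]) simp_all
    then show ?thesis unfolding cyc_coset_eq by blast
  qed
  moreover have "inj_on (\<lambda>i. s * q ^ i mod n) {..<2 * p}"
    by (intro inj_onI) (metis distinct lessThan_iff linorder_neqE_nat)
  ultimately show "card (cyc_coset q n s) = 2 * p" by (simp add: card_image)
qed

end


section \<open>Cyclic codes over a finite field\<close>

text \<open>Multiplication by a nonzero \<open>x\<close> permutes the nonzero elements; comparing
  the products of all of them gives the claim.\<close>

lemma finite_field_power_card:
  fixes x :: "'a::{field,finite}"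
  shows "x ^ card (UNIV :: 'a set) = x"
proof (cases "x = 0")
  case True
  then show ?thesis by (simp add: power_0_left)
next
  case False
  let ?P = "\<Prod>y\<in>UNIV - {0::'a}. y"
  have "bij_betw ((*) x) (UNIV - {0}) (UNIV - {0})"
    using False by (intro bij_betw_byWitness[where f' = "\<lambda>y. y / x"]) auto
  then have "(\<Prod>y\<in>UNIV - {0}. x * y) = ?P"
    by (rule prod.reindex_bij_betw)
  then have "x ^ (card (UNIV :: 'a set) - 1) * ?P = ?P"
    by (simp add: prod.distrib card_Diff_singleton)
  moreover have "?P \<noteq> 0" by simp
  ultimately have "x ^ (card (UNIV :: 'a set) - 1) = 1" by simp
  moreover have "card (UNIV :: 'a set) > 0" by (simp add: card_gt_0_iff)
  ultimately show ?thesis by (metis mult.right_neutral power_minus_mult mult_1)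
qed

text \<open>A shorter period would leave too few powers to cover all nonzero elements. The field
  with two elements is excluded because there \<open>a = 0\<close> satisfies \<open>gen\<close>
  through \<open>0 ^ 0 = 1\<close>.\<close>

lemma generator_power_eq_1_iff:
  fixes a :: "'b::{field,finite}"
  assumes gen: "\<forall>y::'b. y \<noteq> 0 \<longrightarrow> (\<exists>k. y = a ^ k)"
    and card: "card (UNIV :: 'b set) > 2"
  shows "a ^ k = 1 \<longleftrightarrow> (card (UNIV :: 'b set) - 1) dvd k"
proof -
  let ?Q = "card (UNIV :: 'b set)"
  have a0: "a \<noteq> 0"
  proof
    assume "a = 0"
    then have "y = 0 \<or> y = 1" for y :: 'b
      using gen by (metis power_0_left)
    then have "(UNIV :: 'b set) \<subseteq> {0, 1}" by auto
    then have "?Q \<le> card {0::'b, 1}" by (intro card_mono) auto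
    then show False using card by simp
  qed
  have "a * a ^ (?Q - 1) = a"
    using finite_field_power_card[of a] card by (metis One_nat_def Suc_diff_Suc diff_zero power_Suc gr_zeroI less_nat_zero_code)
  then have aQ: "a ^ (?Q - 1) = 1" using a0 by simp
  have least: "\<not> (0 < j \<and> j < ?Q - 1 \<and> a ^ j = 1)" for j
  proof
    assume j: "0 < j \<and> j < ?Q - 1 \<and> a ^ j = 1"
    have "UNIV - {0} \<subseteq> (\<lambda>k. a ^ k) ` {..<j}"
    proof
      fix y :: 'b assume "y \<in> UNIV - {0}"
      then obtain k where "y = a ^ k" using gen by auto
      also have "a ^ k = a ^ (j * (k div j) + k mod j)" by simp
      also have "\<dots> = a ^ (k mod j)" using j by (simp only: power_add power_mult) simp
      finally show "y \<in> (\<lambda>k. a ^ k) ` {..<j}" using j by auto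
    qed
    then have "card (UNIV - {0::'b}) \<le> card {..<j}"
      by (meson card_image_le card_mono finite_imageI finite_lessThan le_trans)
    then show False using j by (simp add: card_Diff_singleton)
  qed
  show ?thesis
  proof
    assume k: "a ^ k = 1"
    have "a ^ k = a ^ ((?Q - 1) * (k div (?Q - 1)) + k mod (?Q - 1))" by simp
    also have "\<dots> = a ^ (k mod (?Q - 1))" using aQ by (simp only: power_add power_mult) simp
    finally have "a ^ (k mod (?Q - 1)) = 1" using k by simp
    moreover have "k mod (?Q - 1) < ?Q - 1" using card by simp
    ultimately have "k mod (?Q - 1) = 0" using least[of "k mod (?Q - 1)"] by (metis gr0I)
    then show "(?Q - 1) dvd k" by auto
  next
    assume "(?Q - 1) dvd k"
    then obtain c where "k = (?Q - 1) * c" by auto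
    then show "a ^ k = 1" using aQ by (simp only: power_mult) simp
  qed
qed

lemma poly_sum_lessThan:
  fixes p :: "'a::comm_semiring_1 poly"
  assumes "degree p < n"
  shows "poly p x = (\<Sum>i<n. Polynomial.coeff p i * x ^ i)"
proof -
  have "poly p x = (\<Sum>i\<le>degree p. Polynomial.coeff p i * x ^ i)" by (rule poly_altdef)
  also have "\<dots> = (\<Sum>i<n. Polynomial.coeff p i * x ^ i)"
    using assms by (intro sum.mono_neutral_left) (auto simp: coeff_eq_0)
  finally show ?thesis .
qed

lemma prod_linear_dvd_iff:
  fixes f :: "'i \<Rightarrow> 'a::field"
  assumes "finite S" "inj_on f S"
  shows "(\<Prod>z\<in>S. [:- f z, 1:]) dvd p \<longleftrightarrow> (\<forall>z\<in>S. poly p (f z) = 0)"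
  using assms
proof (induction S arbitrary: p rule: finite_induct)
  case (insert z S)
  show ?case
  proof
    assume "(\<Prod>z\<in>insert z S. [:- f z, 1:]) dvd p"
    then have "[:- f w, 1:] dvd p" if "w \<in> insert z S" for w
      using that insert.hyps by (meson dvd_prodI dvd_trans finite.insertI)
    then show "\<forall>w\<in>insert z S. poly p (f w) = 0" by (simp add: poly_eq_0_iff_dvd)
  next
    assume *: "\<forall>w\<in>insert z S. poly p (f w) = 0"
    then obtain r where r: "p = [:- f z, 1:] * r" by (auto simp: poly_eq_0_iff_dvd)
    have "\<forall>w\<in>S. poly r (f w) = 0"
    proof
      fix w assume w: "w \<in> S"
      then have "f w \<noteq> f z" using insert by (auto simp: inj_on_def)
      moreover have "poly p (f w) = 0" using * w by auto
      ultimately show "poly r (f w) = 0" unfolding r by (simp del: mult_pCons_left)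
    qed
    then have "(\<Prod>z\<in>S. [:- f z, 1:]) dvd r" using insert by auto
    then show "(\<Prod>z\<in>insert z S. [:- f z, 1:]) dvd p"
      unfolding r using insert.hyps by (simp del: mult_pCons_left mult_pCons_right add: mult_dvd_mono)
  qed
qed auto

lemma degree_prod_linear:
  fixes f :: "'i \<Rightarrow> 'a::field"
  shows "degree (\<Prod>z\<in>S. [:- f z, 1:]) = card S"
  by (subst degree_prod_eq_sum_degree) auto

lemma monic_dvd_antisym:
  fixes p r :: "'a::field poly"
  assumes "p dvd r" "r dvd p" "lead_coeff p = 1" "lead_coeff r = 1"
  shows "p = r"
proof -
  obtain c where c: "r = p * c" using assms(1) by auto
  have nz: "p \<noteq> 0" "r \<noteq> 0" using assms by auto
  then have "degree c = 0"
    using dvd_imp_degree_le[OF assms(2)] c by (auto simp: degree_mult_eq)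
  then obtain d where d: "c = [:d:]" by (rule degree_eq_zeroE)
  have "lead_coeff r = lead_coeff p * lead_coeff c"
    unfolding c by (rule lead_coeff_mult)
  then have "d = 1" using assms d by simp
  then show ?thesis using c d by (simp add: one_pCons flip: one_pCons)
qed

section \<open>Field embeddings, their action on polynomials, minimal polynomials\<close>

locale field_embedding =
  fixes emb :: "'a::field \<Rightarrow> 'b::field"
  assumes emb_one: "emb 1 = 1"
    and emb_add: "emb (x + y) = emb x + emb y"
    and emb_mult: "emb (x * y) = emb x * emb y"
begin

lemma emb_zero [simp]: "emb 0 = 0"
  using emb_add[of 0 0] by (metis add_cancel_right_right add_0)

lemma emb_uminus: "emb (- x) = - emb x"
  using emb_add[of x "- x"] by (simp add: eq_neg_iff_add_eq_0 add.commute)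

lemma emb_eq_0_iff [simp]: "emb x = 0 \<longleftrightarrow> x = 0"
  using emb_mult[of x "inverse x"] emb_one by (cases "x = 0") auto

lemma emb_eq_iff [simp]: "emb x = emb y \<longleftrightarrow> x = y"
  using emb_eq_0_iff[of "x - y"] emb_add[of x "- y"]
  by (simp add: emb_uminus del: emb_eq_0_iff)

lemma emb_power: "emb (x ^ k) = emb x ^ k"
  by (induction k) (simp_all add: emb_one emb_mult)

lemma emb_sum: "emb (sum f A) = (\<Sum>x\<in>A. emb (f x))"
  by (induction A rule: infinite_finite_induct) (simp_all add: emb_add)

abbreviation "epoly \<equiv> map_poly emb"

lemma coeff_epoly [simp]: "Polynomial.coeff (epoly p) i = emb (Polynomial.coeff p i)"
  by (simp add: coeff_map_poly)

lemma degree_epoly [simp]: "degree (epoly p) = degree p"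
  by (rule degree_map_poly) simp

lemma epoly_eq_0_iff [simp]: "epoly p = 0 \<longleftrightarrow> p = 0"
  by (simp add: poly_eq_iff)

lemma epoly_add: "epoly (p + r) = epoly p + epoly r"
  by (simp add: poly_eq_iff emb_add)

lemma epoly_diff: "epoly (p - r) = epoly p - epoly r"
  using epoly_add[of "p - r" r] by simp

lemma epoly_mult: "epoly (p * r) = epoly p * epoly r"
  by (simp add: poly_eq_iff coeff_mult emb_sum emb_mult)

lemma epoly_one: "epoly 1 = 1"
  by (simp add: poly_eq_iff emb_one)

lemma epoly_prod: "epoly (prod f A) = (\<Prod>x\<in>A. epoly (f x))"
  by (induction A rule: infinite_finite_induct) (simp_all add: epoly_one epoly_mult)

lemma emb_poly: "emb (poly p x) = poly (epoly p) (emb x)"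
  by (simp add: poly_altdef emb_sum emb_mult emb_power)

text \<open>Division with remainder survives the embedding with unchanged degrees, so a nonzero
  remainder would be divisible by a polynomial of larger degree.\<close>

lemma epoly_dvd_iff: "epoly p dvd epoly r \<longleftrightarrow> p dvd r"
proof
  assume dvd: "epoly p dvd epoly r"
  show "p dvd r"
  proof (cases "p = 0")
    case True
    then show ?thesis using dvd by simp
  next
    case False
    have "epoly r = epoly p * epoly (r div p) + epoly (r mod p)"
      by (simp flip: epoly_mult epoly_add)
    then have "epoly p dvd epoly (r mod p)"
      using dvd by (simp add: dvd_add_right_iff)
    moreover have "r mod p = 0 \<or> degree (r mod p) < degree p"
      using False degree_mod_less by blast
    ultimately have "r mod p = 0"
      using dvd_imp_degree_le[of "epoly p" "epoly (r mod p)"] by (metis degree_epoly epoly_eq_0_iff not_le)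
    then show ?thesis by auto
  qed
next
  assume "p dvd r"
  then show "epoly p dvd epoly r" by (auto simp: epoly_mult)
qed

text \<open>Algebraicity makes the \<open>THE\<close> in \<open>min_poly\<close> meaningful: a monic
  annihilator of least degree exists, divides every annihilator, and two such polynomials divide
  each other.\<close>

lemma min_poly_dvd_iff:
  assumes alg: "\<exists>p. p \<noteq> 0 \<and> poly (epoly p) x = 0"
  shows "min_poly emb x dvd r \<longleftrightarrow> poly (epoly r) x = 0"
proof -
  let ?R = "\<lambda>p. p \<noteq> 0 \<and> poly (epoly p) x = 0"
  let ?M = "\<lambda>p. lead_coeff p = 1 \<and> poly (epoly p) x = 0 \<and>
      (\<forall>r. r \<noteq> 0 \<and> poly (epoly r) x = 0 \<longrightarrow> degree p \<le> degree r)"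
  obtain p where p: "?R p" and min: "\<forall>r. ?R r \<longrightarrow> degree p \<le> degree r"
    using ex_has_least_nat[of ?R _ degree] alg by blast
  define p' where "p' = Polynomial.smult (inverse (lead_coeff p)) p"
  have p': "?M p'"
    using p min by (auto simp: p'_def epoly_mult[of "[:_:]", simplified] map_poly_smult emb_mult)
  have dvd: "s dvd r \<longleftrightarrow> poly (epoly r) x = 0" if s: "?M s" for s r
  proof
    assume "s dvd r"
    then show "poly (epoly r) x = 0" using s by (auto simp: epoly_mult)
  next
    assume r: "poly (epoly r) x = 0"
    have s0: "s \<noteq> 0" using s by auto
    have "epoly r = epoly s * epoly (r div s) + epoly (r mod s)"
      by (simp flip: epoly_mult epoly_add)
    then have "poly (epoly (r mod s)) x = 0"
      using r s by simp
    moreover have "r mod s = 0 \<or> degree (r mod s) < degree s"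
      using s0 degree_mod_less by blast
    ultimately have "r mod s = 0" using s by (meson not_le)
    then show "s dvd r" by auto
  qed
  have "\<exists>!p. ?M p"
  proof (rule ex1I[of _ p'])
    show "?M p'" by (rule p')
    fix s assume s: "?M s"
    have "s dvd p'" "p' dvd s"
      using dvd[OF s, of p'] dvd[OF p', of s] s p' by auto
    then show "s = p'" using s p' by (intro monic_dvd_antisym) auto
  qed
  then have "?M (min_poly emb x)" unfolding min_poly_def by (rule theI')
  then show ?thesis by (rule dvd)
qed

end

section \<open>Cyclic codes described by their zeros\<close>

text \<open>Only the order of \<beta> and additivity of the \<open>q\<close>-th power map are
  assumed, which keeps the coding theory independent of the characteristic and of the choice of a
  generator.\<close>

locale cyclic_code_field = field_embedding emb
  for emb :: "'a::{field,finite} \<Rightarrow> 'b::{field,finite}" +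
  fixes \<beta> :: 'b and n q :: nat
  assumes card_base: "card (UNIV :: 'a set) = q"
    and frobenius_add: "(x + y :: 'b) ^ q = x ^ q + y ^ q"
    and n_pos: "n > 0"
    and beta_power_eq_1_iff: "\<beta> ^ k = 1 \<longleftrightarrow> n dvd k"
begin

lemma q_gt_1: "q > 1"
proof -
  have "card {0::'a, 1} \<le> card (UNIV :: 'a set)" by (intro card_mono) auto
  then show ?thesis using card_base by simp
qed

lemma beta_nonzero [simp]: "\<beta> \<noteq> 0"
  using beta_power_eq_1_iff[of n] n_pos by (auto simp: power_0_left)

lemma beta_power_eq_iff: "\<beta> ^ i = \<beta> ^ j \<longleftrightarrow> [i = j] (mod n)"
proof (induction i j rule: linorder_wlog)
  case (le i j)
  have "\<beta> ^ j = \<beta> ^ i * \<beta> ^ (j - i)" using le by (simp flip: power_add)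
  then have "\<beta> ^ i = \<beta> ^ j \<longleftrightarrow> n dvd (j - i)"
    using beta_power_eq_1_iff[of "j - i"] by auto
  also have "\<dots> \<longleftrightarrow> [i = j] (mod n)"
    using le by (metis cong_altdef_nat cong_sym_eq)
  finally show ?case .
next
  case (sym i j)
  then show ?case by (metis cong_sym_eq)
qed

lemma beta_power_mod: "\<beta> ^ (i mod n) = \<beta> ^ i"
  by (simp add: beta_power_eq_iff)

lemma inj_on_beta_power: "S \<subseteq> {..<n} \<Longrightarrow> inj_on (\<lambda>z. \<beta> ^ z) S"
  by (intro inj_onI) (metis beta_power_eq_iff cong_less_modulus_unique_nat lessThan_iff subsetD)

text \<open>The base field supplies \<open>q\<close> roots of \<open>x ^ q - x\<close>, and this
  polynomial has no more than \<open>q\<close>.\<close>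

lemma range_emb: "range emb = {x. x ^ q = x}"
proof -
  let ?p = "Polynomial.monom 1 q - Polynomial.monom 1 1 :: 'b poly"
  have "Polynomial.coeff ?p q \<noteq> 0" using q_gt_1 by simp
  then have "?p \<noteq> 0" by (metis coeff_0)
  then have "card {x. poly ?p x = 0} \<le> degree ?p" by (rule card_poly_roots_bound)
  also have "\<dots> \<le> q"
    using q_gt_1 by (intro degree_diff_le) (auto simp: degree_monom_eq)
  finally have "card {x::'b. x ^ q = x} \<le> card (range emb)"
    by (simp add: poly_monom card_image inj_def card_base)
  moreover have "range emb \<subseteq> {x. x ^ q = x}"
    using finite_field_power_card[where ?'a = 'a] by (auto simp: card_base simp flip: emb_power)
  ultimately show ?thesis by (intro card_seteq) auto
qed

text \<open>As a field embedding of the extension into itself, the Frobenius map acts on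
  coefficients through \<open>frob.epoly\<close>, with all rules for \<open>epoly\<close>
  available.\<close>

sublocale frob: field_embedding "\<lambda>x::'b. x ^ q"
  by unfold_locales (simp_all add: frobenius_add power_mult_distrib)

definition q_closed :: "nat set \<Rightarrow> bool" where
  "q_closed S \<longleftrightarrow> S \<subseteq> {..<n} \<and> (\<forall>z\<in>S. z * q mod n \<in> S)"

definition gen_ext :: "nat set \<Rightarrow> 'b poly" where
  "gen_ext S = (\<Prod>z\<in>S. [:- (\<beta> ^ z), 1:])"

lemma gen_ext_dvd_iff:
  assumes "S \<subseteq> {..<n}"
  shows "gen_ext S dvd p \<longleftrightarrow> (\<forall>z\<in>S. poly p (\<beta> ^ z) = 0)"
  unfolding gen_ext_def using assms
  by (intro prod_linear_dvd_iff) (auto intro: inj_on_beta_power finite_subset)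

text \<open>Galois descent: Frobenius permutes the roots, injectively since \<open>q\<close> is
  invertible modulo \<open>n\<close>. It therefore fixes the coefficients of the product, and its
  fixed points form the base field.\<close>

lemma emb_generator_exists:
  assumes S: "q_closed S" and cop: "coprime q n"
  shows "\<exists>g. epoly g = gen_ext S"
proof -
  let ?s = "\<lambda>z. z * q mod n"
  have fin: "finite S" using S by (auto simp: q_closed_def intro: finite_subset)
  have "inj_on ?s S"
  proof (rule inj_onI)
    fix x y assume xy: "x \<in> S" "y \<in> S" "x * q mod n = y * q mod n"
    then have "[x = y] (mod n)"
      using cop cong_mult_rcancel_nat by (auto simp: cong_def[symmetric])
    then show "x = y" using xy S
      by (metis q_closed_def cong_less_modulus_unique_nat lessThan_iff subsetD)
  qed
  then have bij: "bij_betw ?s S S"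
    using fin S endo_inj_surj[OF fin _ \<open>inj_on ?s S\<close>]
    unfolding bij_betw_def q_closed_def by blast
  have "frob.epoly (gen_ext S) = (\<Prod>z\<in>S. [:- (\<beta> ^ ?s z), 1:])"
    unfolding gen_ext_def frob.epoly_prod
    by (intro prod.cong refl)
       (simp add: map_poly_pCons frob.emb_uminus beta_power_mod power_mult)
  also have "\<dots> = gen_ext S"
    unfolding gen_ext_def by (rule prod.reindex_bij_betw[OF bij])
  finally have "Polynomial.coeff (gen_ext S) i ^ q = Polynomial.coeff (gen_ext S) i" for i
    by (metis frob.coeff_epoly)
  then have ran: "Polynomial.coeff (gen_ext S) i \<in> range emb" for i
    by (simp add: range_emb)
  \<comment> \<open>The explicit value at 0 gives \<open>coeff_map_poly\<close> the condition
    \<open>inv_emb 0 = 0\<close> that it asks for.\<close>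
  define inv_emb where "inv_emb = (\<lambda>x. if x = 0 then 0 else inv_into UNIV emb x)"
  have "epoly (map_poly inv_emb (gen_ext S)) = gen_ext S"
    by (rule poly_eqI)
       (use ran in \<open>auto simp: coeff_map_poly inv_emb_def f_inv_into_f\<close>)
  then show ?thesis by blast
qed

definition zero_code :: "nat set \<Rightarrow> 'a poly set" where
  "zero_code S = {c. degree c < n \<and> (\<forall>z\<in>S. poly (epoly c) (\<beta> ^ z) = 0)}"

lemma frob_orbit_zero:
  assumes "poly (epoly c) x = 0"
  shows "poly (epoly c) (x ^ (q ^ i)) = 0"
proof (induction i)
  case (Suc i)
  have emb_inv: "emb y ^ q = emb y" for y using range_emb by auto
  have "poly (epoly c) (x ^ (q ^ i)) ^ q = poly (frob.epoly (epoly c)) ((x ^ (q ^ i)) ^ q)"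
    by (rule frob.emb_poly)
  also have "frob.epoly (epoly c) = epoly c"
    by (simp add: poly_eq_iff emb_inv)
  finally show ?case using Suc q_gt_1 by (simp add: power_mult mult.commute flip: power_mult)
qed (use assms in simp)

text \<open>The defining set of the code with prescribed zero exponents \<open>I\<close>, which need
  not be reduced modulo \<open>n\<close>.\<close>

definition zset :: "nat set \<Rightarrow> nat set" where
  "zset I = {i * q ^ k mod n | i k. i \<in> I}"

lemma q_closed_zset: "q_closed (zset I)"
proof -
  have "z * q mod n \<in> zset I" if z: "z \<in> zset I" for z
  proof -
    obtain i k where ik: "z = i * q ^ k mod n" "i \<in> I" using z by (auto simp: zset_def)
    then have "z * q mod n = i * q ^ Suc k mod n"
      by (simp add: mod_mult_left_eq mult_ac) (simp add: mod_mult_right_eq mult_ac)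
    then show ?thesis using ik unfolding zset_def by blast
  qed
  moreover have "zset I \<subseteq> {..<n}" using n_pos by (auto simp: zset_def)
  ultimately show ?thesis by (simp add: q_closed_def)
qed

lemma zero_on_zset_iff:
  "(\<forall>z\<in>zset I. poly (epoly c) (\<beta> ^ z) = 0) \<longleftrightarrow> (\<forall>i\<in>I. poly (epoly c) (\<beta> ^ i) = 0)"
proof safe
  fix i assume *: "\<forall>z\<in>zset I. poly (epoly c) (\<beta> ^ z) = 0" and "i \<in> I"
  then have "i * q ^ 0 mod n \<in> zset I" unfolding zset_def by blast
  then show "poly (epoly c) (\<beta> ^ i) = 0" using * by (metis beta_power_mod mult.right_neutral power_0)
next
  fix z assume *: "\<forall>i\<in>I. poly (epoly c) (\<beta> ^ i) = 0" and "z \<in> zset I"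
  then obtain i k where "z = i * q ^ k mod n" "i \<in> I" by (auto simp: zset_def)
  then show "poly (epoly c) (\<beta> ^ z) = 0"
    using * frob_orbit_zero[of c "\<beta> ^ i" k] by (simp add: beta_power_mod power_mult)
qed

lemma zero_code_eq_multiples:
  assumes S: "S \<subseteq> {..<n}" and g: "epoly g = gen_ext S"
  shows "zero_code S = {c. degree c < n \<and> g dvd c}"
  unfolding zero_code_def gen_ext_dvd_iff[OF S, symmetric] g[symmetric] epoly_dvd_iff ..

text \<open>Being divisible by all the minimal polynomials means vanishing at the listed powers,
  hence on their Frobenius orbits, hence being divisible by the descended generator
  \<open>g\<close>. As \<open>g\<close> is monic, it is the polynomial selected by
  \<open>poly_lcm\<close>.\<close>

lemma bch_code_eq_zero_code:
  assumes cop: "coprime q n"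
  shows "bch_code emb \<beta> n \<delta> b = zero_code (zset {b..b + \<delta> - 2})"
proof -
  let ?I = "{b..b + \<delta> - 2}" and ?S = "zset {b..b + \<delta> - 2}"
  let ?P = "(\<lambda>i. min_poly emb (\<beta> ^ i)) ` ?I"
  obtain g where g: "epoly g = gen_ext ?S"
    using emb_generator_exists[OF q_closed_zset cop] by blast
  have SS: "?S \<subseteq> {..<n}" using q_closed_zset by (auto simp: q_closed_def)
  \<comment> \<open>Every power of \<beta> is a root of \<open>x ^ n - 1\<close>, so its minimal
    polynomial is well defined.\<close>
  have alg: "\<exists>p. p \<noteq> 0 \<and> poly (epoly p) (\<beta> ^ i) = 0" for i
  proof -
    have "poly (epoly (Polynomial.monom 1 n - 1)) (\<beta> ^ i) = (\<beta> ^ n) ^ i - 1"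
      by (simp add: epoly_diff epoly_one map_poly_monom emb_one poly_monom mult.commute
          flip: power_mult)
    moreover have "Polynomial.coeff (Polynomial.monom 1 n - 1 :: 'a poly) n \<noteq> 0" using n_pos by simp
    then have "(Polynomial.monom 1 n - 1 :: 'a poly) \<noteq> 0" by (metis coeff_0)
    ultimately show ?thesis using beta_power_eq_1_iff[of n]
      by (intro exI[of _ "Polynomial.monom 1 n - 1"]) auto
  qed
  have all: "(\<forall>p\<in>?P. p dvd h) \<longleftrightarrow> g dvd h" for h
  proof -
    have "(\<forall>p\<in>?P. p dvd h) \<longleftrightarrow> (\<forall>i\<in>?I. poly (epoly h) (\<beta> ^ i) = 0)"
      by (simp add: min_poly_dvd_iff[OF alg])
    also have "\<dots> \<longleftrightarrow> (\<forall>z\<in>?S. poly (epoly h) (\<beta> ^ z) = 0)"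
      by (simp add: zero_on_zset_iff)
    also have "\<dots> \<longleftrightarrow> g dvd h"
      using gen_ext_dvd_iff[OF SS] g epoly_dvd_iff by metis
    finally show ?thesis .
  qed
  have "emb (lead_coeff g) = lead_coeff (gen_ext ?S)" by (simp flip: g)
  also have "\<dots> = 1" unfolding gen_ext_def by (simp add: lead_coeff_prod)
  finally have monic: "lead_coeff g = 1" by (metis emb_one emb_eq_iff)
  have g_mult: "\<forall>p\<in>?P. p dvd g" using all[of g] by (simp only: dvd_refl)
  have "poly_lcm ?P = g" unfolding poly_lcm_def
  proof (rule the_equality)
    show "lead_coeff g = 1 \<and> (\<forall>p\<in>?P. p dvd g) \<and> (\<forall>h. (\<forall>p\<in>?P. p dvd h) \<longrightarrow> g dvd h)"
      using monic g_mult by (simp only: all) simp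
    fix s assume s: "lead_coeff s = 1 \<and> (\<forall>p\<in>?P. p dvd s) \<and> (\<forall>h. (\<forall>p\<in>?P. p dvd h) \<longrightarrow> s dvd h)"
    then have "s dvd g" "g dvd s" using g_mult all[of s] by (simp_all only:)
    then show "s = g" using s monic by (intro monic_dvd_antisym) simp_all
  qed
  then show ?thesis
    unfolding bch_code_def Let_def zero_code_eq_multiples[OF SS g] by (simp only:)
qed

lemma subspace_zero_code: "poly_vs.subspace (zero_code S)"
  by (auto simp: poly_vs.subspace_def zero_code_def n_pos epoly_add map_poly_smult emb_mult
      intro: degree_add_less)

text \<open>The shifts \<open>g * x ^ i\<close> with \<open>i < n - card S\<close> form a basis,
  since the generator \<open>g\<close> over the base field has degree \<open>card S\<close>.\<close>

lemma dim_zero_code: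
  assumes S: "q_closed S" and cop: "coprime q n"
  shows "poly_vs.dim (zero_code S) = n - card S"
proof -
  obtain g where g: "epoly g = gen_ext S" using emb_generator_exists[OF S cop] by blast
  have SS: "S \<subseteq> {..<n}" using S by (simp add: q_closed_def)
  have deg: "degree g = card S"
    using degree_prod_linear[of "\<lambda>z. \<beta> ^ z" S] degree_epoly[of g] g
    by (simp add: gen_ext_def del: degree_epoly)
  have "finite S" using SS by (rule finite_subset) simp
  then have g0: "g \<noteq> 0" using g by (auto simp: gen_ext_def)
  let ?e = "\<lambda>i. g * Polynomial.monom 1 i" and ?K = "{..<n - card S}"
  have inj: "inj_on ?e ?K"
  proof (rule inj_onI)
    fix i j assume "?e i = ?e j"
    then have "Polynomial.monom (1::'a) i = Polynomial.monom 1 j" using g0 by simp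
    then show "i = j" by (simp add: monom_eq_iff')
  qed
  have sum_e: "(\<Sum>i\<in>?K. Polynomial.smult (f i) (?e i)) = g * (\<Sum>i\<in>?K. Polynomial.monom (f i) i)" for f
    by (simp add: sum_distrib_left smult_monom flip: mult_smult_right)
  have mem: "?e i \<in> zero_code S" if "i \<in> ?K" for i
    using that g0 deg
    by (auto simp: zero_code_eq_multiples[OF SS g] degree_mult_eq degree_monom_eq)
  show ?thesis
  proof (rule poly_vs.dim_unique[of "?e ` ?K"])
    show "?e ` ?K \<subseteq> zero_code S" using mem by blast
    show "zero_code S \<subseteq> poly_vs.span (?e ` ?K)"
    proof
      fix c assume "c \<in> zero_code S"
      then obtain r where r: "c = g * r" and dc: "degree c < n"
        by (auto simp: zero_code_eq_multiples[OF SS g])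
      have "Polynomial.coeff r i = 0" if "i \<ge> n - card S" for i
      proof (cases "r = 0")
        case False
        then have "degree r < i" using dc that g0 deg by (simp add: r degree_mult_eq)
        then show ?thesis by (rule coeff_eq_0)
      qed simp
      then have "r = (\<Sum>i\<in>?K. Polynomial.monom (Polynomial.coeff r i) i)"
        by (auto simp: poly_eq_iff coeff_sum sum.delta)
      then have "c = (\<Sum>i\<in>?K. Polynomial.smult (Polynomial.coeff r i) (?e i))"
        using sum_e r by metis
      moreover have "(\<Sum>i\<in>?K. Polynomial.smult (Polynomial.coeff r i) (?e i)) \<in> poly_vs.span (?e ` ?K)"
        by (intro poly_vs.span_sum poly_vs.span_scale poly_vs.span_base) blast
      ultimately show "c \<in> poly_vs.span (?e ` ?K)" by simp
    qed
    show "poly_vs.independent (?e ` ?K)"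
    proof (rule poly_vs.independent_if_scalars_zero)
      fix f x assume sum0: "(\<Sum>x\<in>?e ` ?K. Polynomial.smult (f x) x) = 0" and x: "x \<in> ?e ` ?K"
      then obtain j where j: "x = ?e j" "j \<in> ?K" by auto
      have "(\<Sum>i\<in>?K. Polynomial.smult (f (?e i)) (?e i)) = 0"
        using sum0 by (simp add: sum.reindex[OF inj])
      then have "(\<Sum>i\<in>?K. Polynomial.monom (f (?e i)) i) = 0"
        using g0 by (simp add: sum_e)
      then have "Polynomial.coeff (\<Sum>i\<in>?K. Polynomial.monom (f (?e i)) i) j = 0" by simp
      then show "f x = 0" using j by (simp add: coeff_sum sum.delta)
    qed simp
    show "card (?e ` ?K) = n - card S" using inj by (simp add: card_image)
  qed
qed

lemma poly_eq_0_if_all_zeros: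
  assumes "degree c < n" "\<And>j. j < n \<Longrightarrow> poly c (\<beta> ^ j) = 0"
  shows "c = 0"
proof (rule ccontr)
  assume "c \<noteq> 0"
  then have "card {x. poly c x = 0} \<le> degree c" by (rule card_poly_roots_bound)
  moreover have "card ((\<lambda>j. \<beta> ^ j) ` {..<n}) \<le> card {x. poly c x = 0}"
    using assms(2) by (intro card_mono) auto
  ultimately show False using assms(1) by (simp add: card_image inj_on_beta_power)
qed

lemma is_LCD_zero_code:
  assumes S: "q_closed S" and cop: "coprime q n"
    and neg: "\<And>z. z \<in> S \<Longrightarrow> (n - z) mod n \<in> S"
  shows "is_LCD n (zero_code S)"
proof -
  obtain g where g: "epoly g = gen_ext S" using emb_generator_exists[OF S cop] by blast
  have SS: "S \<subseteq> {..<n}" using S by (simp add: q_closed_def)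
  note C = zero_code_eq_multiples[OF SS g]
  \<comment> \<open>For \<open>j \<notin> S\<close> the vector with entries \<open>\<beta> ^ (j i)\<close> is a multiple of the generator over the
    extension field, so orthogonality to the code makes \<open>\<beta> ^ j\<close> a zero as well.\<close>
  have "c = 0" if c: "c \<in> zero_code S" and cd: "c \<in> dual_code n (zero_code S)" for c
  proof -
    have dc: "degree c < n" using c by (simp add: zero_code_def)
    have "poly (epoly c) (\<beta> ^ j) = 0" if j: "j < n" for j
    proof (cases "j \<in> S")
      case True
      then show ?thesis using c by (simp add: zero_code_def)
    next
      case jS: False
      define v where "v = (\<Sum>i<n. Polynomial.monom (\<beta> ^ (j * i)) i)"
      have coeff_v: "Polynomial.coeff v i = (if i < n then \<beta> ^ (j * i) else 0)" for i
        by (simp add: v_def coeff_sum sum.delta)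
      have "poly v (\<beta> ^ z) = 0" if z: "z \<in> S" for z
      proof -
        let ?x = "\<beta> ^ (j + z)"
        have "poly v (\<beta> ^ z) = (\<Sum>i<n. ?x ^ i)"
          by (simp add: v_def poly_sum poly_monom power_add power_mult power_mult_distrib)
        \<comment> \<open>Otherwise \<open>j\<close> would be the negative of \<open>z\<close>
          modulo \<open>n\<close>, hence in \<open>S\<close>. As \<open>?x\<close> is an
          \<open>n\<close>-th root of unity other than 1, the geometric sum vanishes.\<close>
        moreover have "?x \<noteq> 1"
        proof
          assume "?x = 1"
          then have "n dvd j + z" by (simp add: beta_power_eq_1_iff)
          then obtain k where k: "j + z = n * k" by auto
          have zn: "z < n" using z SS by auto
          have "k < 2" using k zn j by (metis add_strict_mono mult.commute mult_2 nat_mult_less_cancel1 n_pos)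
          then have "j = (n - z) mod n" using k zn j n_pos
            by (cases "k = 0") (auto simp: less_2_cases_iff)
          then show False using neg[OF z] jS by simp
        qed
        moreover have "?x ^ n = 1"
          by (metis beta_power_eq_1_iff dvd_triv_right power_mult)
        ultimately show ?thesis by (simp add: sum_gp_strict)
      qed
      then obtain r where r: "v = gen_ext S * r"
        using gen_ext_dvd_iff[OF SS, of v] by auto
      have v0: "v \<noteq> 0" using coeff_v[of 0] n_pos by auto
      have "degree v < n"
        using v0 by (intro degree_lessI) (auto simp: coeff_v)
      then have degr: "degree r + degree g < n"
        using v0 degree_epoly[of g] unfolding g r by (auto simp: degree_mult_eq add.commute)
      \<comment> \<open>Duality is known only over the base field. It applies to
        \<open>g * x ^ k\<close>, whose coefficients lie there, and extends by linearity to a scalar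
        \<open>a\<close> of the extension.\<close>
      have orth: "(\<Sum>i<n. emb (Polynomial.coeff c i) * Polynomial.coeff (gen_ext S * Polynomial.monom a k) i) = 0"
        if k: "k \<le> degree r" for a k
      proof -
        have ep: "epoly (g * Polynomial.monom 1 k) = gen_ext S * Polynomial.monom 1 k"
          by (simp add: epoly_mult g map_poly_monom emb_one)
        have "degree (g * Polynomial.monom 1 k) < n"
          using degree_mult_le[of g "Polynomial.monom 1 k"] degr k by (simp add: degree_monom_eq)
        then have "g * Polynomial.monom 1 k \<in> zero_code S" by (simp add: C)
        then have "(\<Sum>i<n. Polynomial.coeff c i * Polynomial.coeff (g * Polynomial.monom 1 k) i) = 0"
          using cd by (simp add: dual_code_def)
        then have "emb (\<Sum>i<n. Polynomial.coeff c i * Polynomial.coeff (g * Polynomial.monom 1 k) i) = 0"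
          by simp
        then have "(\<Sum>i<n. emb (Polynomial.coeff c i) * Polynomial.coeff (gen_ext S * Polynomial.monom 1 k) i) = 0"
          unfolding emb_sum emb_mult coeff_epoly[symmetric, of "g * Polynomial.monom 1 k"] ep .
        then have "a * (\<Sum>i<n. emb (Polynomial.coeff c i) * Polynomial.coeff (gen_ext S * Polynomial.monom 1 k) i) = 0"
          by simp
        moreover have "gen_ext S * Polynomial.monom a k = Polynomial.smult a (gen_ext S * Polynomial.monom 1 k)"
          by (simp add: smult_monom flip: mult_smult_right)
        ultimately show ?thesis by (simp add: sum_distrib_left mult_ac)
      qed
      have v_sum: "v = (\<Sum>k\<le>degree r. gen_ext S * Polynomial.monom (Polynomial.coeff r k) k)"
        unfolding r by (subst poly_as_sum_of_monoms[of r, symmetric]) (simp add: sum_distrib_left)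
      have "poly (epoly c) (\<beta> ^ j) = (\<Sum>i<n. emb (Polynomial.coeff c i) * Polynomial.coeff v i)"
        using dc by (subst poly_sum_lessThan[of _ n]) (simp_all add: coeff_v power_mult)
      also have "\<dots> = (\<Sum>k\<le>degree r. \<Sum>i<n. emb (Polynomial.coeff c i) *
          Polynomial.coeff (gen_ext S * Polynomial.monom (Polynomial.coeff r k) k) i)"
        unfolding v_sum coeff_sum sum_distrib_left by (rule sum.swap)
      also have "\<dots> = 0" by (rule sum.neutral) (use orth in simp)
      finally show ?thesis .
    qed
    then have "epoly c = 0" using dc by (intro poly_eq_0_if_all_zeros) auto
    then show "c = 0" by simp
  qed
  moreover have "0 \<in> zero_code S \<inter> dual_code n (zero_code S)"
    using n_pos by (simp add: zero_code_def dual_code_def)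
  ultimately show ?thesis by (auto simp: is_LCD_def)
qed

text \<open>
  Summing the zeros against the coefficients of the polynomial vanishing at all but one
  position of the support isolates a single nonzero term; no Vandermonde determinant is needed.
\<close>
lemma bch_bound:
  assumes c: "degree c < n" "c \<noteq> 0"
    and zeros: "\<And>k. k < D \<Longrightarrow> poly (epoly c) (\<beta> ^ (a + k)) = 0"
  shows "D < hweight c"
proof (rule ccontr)
  assume "\<not> D < hweight c"
  define T where "T = {i. Polynomial.coeff c i \<noteq> 0}"
  have TS: "T \<subseteq> {..<n}" using c le_degree by (fastforce simp: T_def)
  then have fin: "finite T" by (rule finite_subset) simp
  have cardT: "card T \<le> D" using \<open>\<not> D < hweight c\<close> by (simp add: hweight_def T_def)
  obtain i0 where i0: "i0 \<in> T" using c by (auto simp: T_def poly_eq_iff)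
  define f where "f = (\<Prod>k\<in>T - {i0}. [:- (\<beta> ^ k), 1:])"
  have "degree f = card (T - {i0})" unfolding f_def by (rule degree_prod_linear)
  also have "\<dots> < card T" using i0 fin by (intro card_Diff1_less) auto
  finally have df: "degree f < D" using cardT by simp
  \<comment> \<open>Expanding \<open>f\<close> turns the sum into a combination of the values of
    \<open>c\<close> at the given zeros; \<open>degree f < D\<close> ensures that no other values
    occur.\<close>
  have "(\<Sum>i<n. emb (Polynomial.coeff c i) * \<beta> ^ (a * i) * poly f (\<beta> ^ i))
      = (\<Sum>i<n. \<Sum>k<D. Polynomial.coeff f k * (emb (Polynomial.coeff c i) * (\<beta> ^ (a + k)) ^ i))"
    by (subst poly_sum_lessThan[OF df])
       (simp add: sum_distrib_left power_add power_mult_distrib mult_ac flip: power_mult)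
  also have "\<dots> = (\<Sum>k<D. Polynomial.coeff f k * poly (epoly c) (\<beta> ^ (a + k)))"
    by (subst sum.swap) (simp add: poly_sum_lessThan[of "epoly c" n] c sum_distrib_left)
  also have "\<dots> = 0" using zeros by simp
  finally have "(\<Sum>i<n. emb (Polynomial.coeff c i) * \<beta> ^ (a * i) * poly f (\<beta> ^ i)) = 0" .
  also have "(\<Sum>i<n. emb (Polynomial.coeff c i) * \<beta> ^ (a * i) * poly f (\<beta> ^ i)) =
      (\<Sum>i\<in>{i0}. emb (Polynomial.coeff c i) * \<beta> ^ (a * i) * poly f (\<beta> ^ i))"
  proof (rule sum.mono_neutral_right)
    show "\<forall>i\<in>{..<n} - {i0}. emb (Polynomial.coeff c i) * \<beta> ^ (a * i) * poly f (\<beta> ^ i) = 0"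
    proof
      fix i assume i: "i \<in> {..<n} - {i0}"
      show "emb (Polynomial.coeff c i) * \<beta> ^ (a * i) * poly f (\<beta> ^ i) = 0"
        using i fin by (cases "i \<in> T") (auto simp: T_def f_def poly_prod)
    qed
  qed (use i0 TS in auto)
  finally have "poly f (\<beta> ^ i0) = 0" using i0 by (simp add: T_def)
  then obtain k where "k \<in> T - {i0}" "\<beta> ^ i0 = \<beta> ^ k"
    using fin by (auto simp: f_def poly_prod)
  then show False using inj_onD[OF inj_on_beta_power[OF TS]] i0 by fastforce
qed

end


section \<open>The largest coset leaders\<close>

text \<open>Lets \<open>delta_rep\<close> be evaluated by removing maxima one after another.\<close>

lemma rev_sorted_list_of_set_Max:
  fixes A :: "'a::linorder set"
  assumes "finite A" "A \<noteq> {}"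
  shows "rev (sorted_list_of_set A) = Max A # rev (sorted_list_of_set (A - {Max A}))"
proof -
  have "sorted_list_of_set (A - {Max A}) @ [Max A] = sorted_list_of_set A"
    using assms by (intro sorted_distinct_set_unique) (auto simp: sorted_append intro: Max_in)
  from this[symmetric] show ?thesis by simp
qed

section \<open>Cosets as fibres of the leader map; leaders ranked from the top\<close>

context antipodal_modulus
begin

lemma finite_MinRep: "finite (MinRep q n)"
  by (rule finite_subset[of _ "{..<n}"]) (auto simp: MinRep_def)

lemma zero_in_MinRep: "0 \<in> MinRep q n"
  using n_gt_2 by (simp add: MinRep_iff)

lemma cyc_coset_eqI:
  assumes "x < n" "y \<in> cyc_coset q n x"
  shows "cyc_coset q n y = cyc_coset q n x"
proof -
  have sub: "cyc_coset q n y \<subseteq> cyc_coset q n x" if yx: "y \<in> cyc_coset q n x" for x y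
  proof -
    obtain i where i: "y = x * q ^ i mod n" using yx by (auto simp: cyc_coset_eq)
    have "y * q ^ j mod n = x * q ^ (i + j) mod n" for j
      by (simp add: i mod_mult_left_eq power_add mult.assoc)
    then show ?thesis by (auto simp: cyc_coset_eq)
  qed
  obtain i where i: "y = x * q ^ i mod n" using assms by (auto simp: cyc_coset_eq)
  \<comment> \<open>The factor completes \<open>q ^ i\<close> to a power of
    \<open>q ^ (2 * m)\<close>, which is 1 modulo \<open>n\<close>; this leads from \<open>y\<close>
    back to \<open>x\<close>.\<close>
  have "y * q ^ (2 * m * i - i) mod n = x * q ^ (2 * m * i) mod n"
  proof -
    have "i \<le> 2 * m * i" using m_pos by simp
    then show ?thesis by (simp add: i mod_mult_left_eq mult.assoc flip: power_add)
  qed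
  also have "\<dots> = x" using mod_period[of x "2 * m * i"] assms by simp
  finally have "x \<in> cyc_coset q n y" unfolding cyc_coset_eq by (metis rangeI)
  then show ?thesis using sub assms by blast
qed

definition coset_leader :: "nat \<Rightarrow> nat" where
  "coset_leader x = Min (cyc_coset q n x)"

lemma cyc_coset_less: "y \<in> cyc_coset q n x \<Longrightarrow> y < n"
  using n_gt_2 by (auto simp: cyc_coset_eq)

lemma coset_leader_mem: "coset_leader x \<in> cyc_coset q n x"
  unfolding coset_leader_def by (rule Min_in[OF finite_cyc_coset]) (simp add: cyc_coset_eq)

lemma coset_leader_eq:
  assumes "x < n" "y \<in> cyc_coset q n x"
  shows "coset_leader y = coset_leader x"
  using cyc_coset_eqI[OF assms] by (simp add: coset_leader_def)

lemma coset_leader_in_MinRep: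
  assumes "x < n"
  shows "coset_leader x \<in> MinRep q n"
proof -
  have "coset_leader x = Min (cyc_coset q n (coset_leader x))"
    using coset_leader_eq[OF assms coset_leader_mem] by (simp only: coset_leader_def)
  then show ?thesis using cyc_coset_less[OF coset_leader_mem] by (simp only: MinRep_def mem_Collect_eq)
qed

lemma MinRep_coset_leader: "l \<in> MinRep q n \<Longrightarrow> coset_leader l = l"
  by (simp add: MinRep_def coset_leader_def)

text \<open>As fibres of \<open>coset_leader\<close>, the cosets visibly partition the residues,
  which is what counting exponents requires.\<close>

lemma cyc_coset_MinRep:
  assumes "l \<in> MinRep q n"
  shows "cyc_coset q n l = {x. x < n \<and> coset_leader x = l}"
proof -
  have l: "l < n" using assms by (simp add: MinRep_def)
  show ?thesis
  proof safe
    fix x assume x: "x \<in> cyc_coset q n l"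
    then show "x < n" by (rule cyc_coset_less)
    show "coset_leader x = l" using coset_leader_eq[OF l x] MinRep_coset_leader[OF assms] by simp
  next
    fix x assume x: "x < n" "l = coset_leader x"
    then have "cyc_coset q n l = cyc_coset q n x" by (intro cyc_coset_eqI) (simp_all add: coset_leader_mem)
    then show "x \<in> cyc_coset q n (coset_leader x)" using mem_cyc_coset_self[OF x(1)] x by simp
  qed
qed

lemma coset_leader_eq_0_iff:
  assumes "x < n"
  shows "coset_leader x = 0 \<longleftrightarrow> x = 0"
proof -
  have "cyc_coset q n 0 = {0}" by (auto simp: cyc_coset_eq)
  then show ?thesis using cyc_coset_MinRep[OF zero_in_MinRep] assms by (auto simp: set_eq_iff)
qed

lemma delta_rep_1: "delta_rep q n 1 = Max (MinRep q n)"
proof -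
  have "MinRep q n \<noteq> {}" using zero_in_MinRep by blast
  then show ?thesis
    by (simp add: delta_rep_def rev_sorted_list_of_set_Max finite_MinRep)
qed

text \<open>Nonemptiness keeps the index inside the list; beyond it, \<open>!\<close> has no
  specified value.\<close>

lemma delta_rep_2:
  assumes "MinRep q n - {delta_rep q n 1} \<noteq> {}"
  shows "delta_rep q n 2 = Max (MinRep q n - {delta_rep q n 1})"
proof -
  have "MinRep q n \<noteq> {}" using zero_in_MinRep by blast
  then show ?thesis using assms unfolding delta_rep_1
    by (simp add: delta_rep_def rev_sorted_list_of_set_Max finite_MinRep)
qed

lemma delta_rep_3:
  assumes "MinRep q n - {delta_rep q n 1} - {delta_rep q n 2} \<noteq> {}"
  shows "delta_rep q n 3 = Max (MinRep q n - {delta_rep q n 1} - {delta_rep q n 2})"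
proof -
  have "MinRep q n \<noteq> {}" using zero_in_MinRep by blast
  moreover have ne: "MinRep q n - {delta_rep q n 1} \<noteq> {}" using assms by blast
  ultimately show ?thesis using assms unfolding delta_rep_2[OF ne] unfolding delta_rep_1
    by (simp add: delta_rep_def rev_sorted_list_of_set_Max finite_MinRep numeral_3_eq_3)
qed

end

section \<open>The exponent \<open>m = 4 * t + 2\<close>: the two largest leaders and their
  cosets\<close>

text \<open>The quotient of \<open>q ^ (4 * t + 2) + 1\<close> by \<open>q ^ 2 + 1\<close>, the
  alternating sum of even powers of \<open>q\<close>. The recursion avoids division and relates the
  values \<open>N\<close> and \<open>M\<close> for consecutive \<open>t\<close>.\<close>

fun alt_quot :: "int \<Rightarrow> nat \<Rightarrow> int" where
  "alt_quot q 0 = 1"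
| "alt_quot q (Suc t) = q ^ 4 * alt_quot q t - q\<^sup>2 + 1"

lemma alt_quot_mult: "(q\<^sup>2 + 1) * alt_quot q t = q ^ (4 * t + 2) + 1"
proof (induction t)
  case (Suc t)
  have "(q\<^sup>2 + 1) * alt_quot q (Suc t) = q ^ 4 * ((q\<^sup>2 + 1) * alt_quot q t) - (q\<^sup>2 + 1) * (q\<^sup>2 - 1)"
    by (simp add: algebra_simps)
  also have "\<dots> = q ^ 4 * (q ^ (4 * t + 2)) + 1"
    unfolding Suc by (simp add: algebra_simps power2_eq_square power4_eq_xxxx)
  also have "q ^ 4 * (q ^ (4 * t + 2)) = q ^ (4 * Suc t + 2)"
    unfolding power_add[symmetric] by (rule arg_cong[of _ _ "power q"]) simp
  finally show ?case .
qed (simp add: power2_eq_square)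

lemma alt_quot_pos:
  assumes "q > 0"
  shows "alt_quot q t > 0"
proof -
  have "(q\<^sup>2 + 1) * alt_quot q t > 0" unfolding alt_quot_mult using assms by (simp add: add_pos_pos)
  moreover have "q\<^sup>2 + 1 > 0" by (simp add: add_nonneg_pos)
  ultimately show ?thesis by (simp only: zero_less_mult_pos)
qed

locale antipodal_modulus_2mod4 = antipodal_modulus +
  fixes t :: nat
  assumes m_eq: "m = 4 * t + 2"
begin

abbreviation "Q \<equiv> int q"
abbreviation "N \<equiv> alt_quot Q t"

definition P :: int where "P = int (q div 2)"

definition s1 :: int where "s1 = P * (Q - 1) * N"

lemma Q_eq: "Q = 2 * P" and P_pos: "P \<ge> 1" and Q_ge2: "Q \<ge> 2"
  using q_even q_ge2 by (auto simp: P_def)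

lemma N_pos: "N > 0"
  by (rule alt_quot_pos) (use Q_ge2 in simp)

lemma n_eq: "int n = (Q\<^sup>2 + 1) * N"
  unfolding alt_quot_mult by (simp add: n_def m_eq)

lemma two_s1: "2 * s1 = Q * (Q - 1) * N"
proof -
  have "2 * s1 = (2 * P) * (Q - 1) * N" by (simp only: s1_def mult.assoc)
  then show ?thesis by (simp only: Q_eq[symmetric])
qed

lemma n_minus_two_s1: "int n - 2 * s1 = (Q + 1) * N"
  unfolding two_s1 n_eq by (simp add: algebra_simps power2_eq_square)

lemma two_s1_less: "2 * s1 < int n"
proof -
  have "0 < (Q + 1) * N" using N_pos Q_ge2 by (intro mult_pos_pos) simp_all
  then show ?thesis using n_minus_two_s1 by linarith
qed

lemma s1_pos: "s1 > 0"
  unfolding s1_def using P_pos Q_ge2 N_pos by (intro mult_pos_pos) simp_all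

text \<open>Modulo \<open>n\<close>, \<open>q ^ 2\<close> negates \<open>s1\<close> and
  \<open>q\<close> sends it to \<open>s1 + N\<close>, so \<open>leaderI\<close> applies with
  \<open>p = 2\<close>.\<close>

lemma first_leader: "nat s1 \<in> MinRep q n" "card (cyc_coset q n (nat s1)) = 4"
proof -
  have s1: "int (nat s1) = s1" using s1_pos by simp
  have neg: "[int (nat s1) * Q ^ 2 = - int (nat s1)] (mod int n)"
  proof -
    have "s1 * Q ^ 2 - - s1 = int n * (P * (Q - 1))" by (simp add: s1_def n_eq algebra_simps)
    then show ?thesis unfolding s1 cong_iff_dvd_diff by simp
  qed
  have inner: "\<exists>e r. (e = 1 \<or> e = - 1) \<and> int (nat s1) < r \<and> r < int n - int (nat s1) \<and>
        [int (nat s1) * Q ^ i = e * r] (mod int n)" if "0 < i" "i < 2" for i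
  proof -
    have i: "i = 1" using that by simp
    have "s1 * Q - (s1 + N) = int n * (P - 1)"
    proof -
      \<comment> \<open>Doubling removes the half hidden in \<open>s1\<close>, so that the identity
        becomes one in \<open>Q\<close> and \<open>N\<close>.\<close>
      have "2 * (s1 * Q - (s1 + N)) = (2 * s1) * (Q - 1) - 2 * N" by (simp add: algebra_simps)
      also have "\<dots> = int n * (Q - 2)"
        unfolding two_s1 n_eq by (simp add: algebra_simps power2_eq_square)
      also have "Q - 2 = 2 * (P - 1)" unfolding right_diff_distrib Q_eq[symmetric] by simp
      finally have "2 * (s1 * Q - (s1 + N)) = 2 * (int n * (P - 1))" by simp
      then show ?thesis by simp
    qed
    then have "[s1 * Q ^ i = 1 * (s1 + N)] (mod int n)"
      unfolding cong_iff_dvd_diff using i by simp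
    moreover have "N < (Q + 1) * N" using N_pos Q_ge2 by simp
    ultimately show ?thesis unfolding s1 using N_pos n_minus_two_s1
      by (intro exI[of _ 1] exI[of _ "s1 + N"]) linarith
  qed
  show "nat s1 \<in> MinRep q n" "card (cyc_coset q n (nat s1)) = 4"
    using leaderI[of "nat s1" 2, OF _ _ _ neg inner] s1_pos two_s1_less by simp_all
qed

lemma le_first_leader:
  assumes "s \<in> MinRep q n"
  shows "int s \<le> s1"
proof (cases "s = 0")
  case False
  \<comment> \<open>Modulo \<open>Q + 1\<close>, \<open>Q\<close> is \<open>- 1\<close> and
    \<open>m\<close> is even, so \<open>n\<close> is congruent to 2.\<close>
  have ndvd: "\<not> (Q + 1) dvd int n"
  proof
    assume dvd: "(Q + 1) dvd int n"
    have "[Q = - 1] (mod Q + 1)" by (simp add: cong_iff_dvd_diff)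
    then have "[Q ^ m = (- 1) ^ m] (mod Q + 1)" by (rule cong_pow)
    then have "(Q + 1) dvd Q ^ m - 1" by (simp add: m_eq cong_iff_dvd_diff)
    then have "(Q + 1) dvd int n - (Q ^ m - 1)" using dvd by (rule dvd_diff[rotated])
    then have "(Q + 1) dvd 2" by (simp add: n_def)
    then show False using zdvd_imp_le[of "Q + 1" 2] Q_ge2 by simp
  qed
  show ?thesis unfolding s1_def
    using False by (intro int_leader_le_first[OF Q_eq P_pos n_eq N_pos ndvd MinRep_imp_int_leader[OF assms]]) simp
qed (use s1_pos in simp)

lemma delta_rep_1_eq: "delta_rep q n 1 = nat s1"
  unfolding delta_rep_1
proof (rule Max_eqI[OF finite_MinRep])
  show "nat s1 \<in> MinRep q n" by (rule first_leader)
  show "y \<le> nat s1" if "y \<in> MinRep q n" for y using le_first_leader[OF that] by simp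
qed

lemma delta_rep_2_props:
  "delta_rep q n 2 \<in> MinRep q n" "delta_rep q n 2 < delta_rep q n 1"
  "\<And>s. s \<in> MinRep q n \<Longrightarrow> s \<noteq> delta_rep q n 1 \<Longrightarrow> s \<le> delta_rep q n 2"
proof -
  have "0 \<in> MinRep q n - {delta_rep q n 1}"
    using zero_in_MinRep s1_pos by (simp add: delta_rep_1_eq[unfolded One_nat_def])
  then have ne: "MinRep q n - {delta_rep q n 1} \<noteq> {}" by blast
  have "delta_rep q n 2 \<in> MinRep q n - {delta_rep q n 1}"
    unfolding delta_rep_2[OF ne] by (rule Max_in) (use ne finite_MinRep in auto)
  then show mem: "delta_rep q n 2 \<in> MinRep q n" "delta_rep q n 2 < delta_rep q n 1"
    using le_first_leader[of "delta_rep q n 2"] by (auto simp: delta_rep_1_eq[unfolded One_nat_def] nat_less_iff zless_nat_eq_int_zless less_le)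
  show "s \<le> delta_rep q n 2" if "s \<in> MinRep q n" "s \<noteq> delta_rep q n 1" for s
    unfolding delta_rep_2[OF ne] by (rule Max_ge) (use that finite_MinRep in auto)
qed

text \<open>The hypothesis makes the second leader positive, so 0 remains as a candidate for the
  third. For \<open>q = 2\<close>, \<open>m = 2\<close> only the leaders 1 and 0 exist, and the
  hypothesis fails.\<close>

lemma delta_rep_3_props:
  assumes "delta_rep q n 3 < delta_rep q n 2"
  shows "\<And>s. s \<in> MinRep q n \<Longrightarrow> s \<noteq> delta_rep q n 1 \<Longrightarrow> s \<noteq> delta_rep q n 2 \<Longrightarrow> s \<le> delta_rep q n 3"
proof -
  have "0 \<in> MinRep q n - {delta_rep q n 1} - {delta_rep q n 2}"
    using zero_in_MinRep s1_pos assms by (simp add: delta_rep_1_eq[unfolded One_nat_def])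
  then have ne: "MinRep q n - {delta_rep q n 1} - {delta_rep q n 2} \<noteq> {}" by blast
  show "s \<le> delta_rep q n 3" if "s \<in> MinRep q n" "s \<noteq> delta_rep q n 1" "s \<noteq> delta_rep q n 2" for s
    unfolding delta_rep_3[OF ne] by (rule Max_ge) (use that finite_MinRep in auto)
qed

text \<open>Here \<open>q ^ 2\<close> is \<open>- 1\<close> modulo \<open>n\<close>. If
  \<open>q\<close> sent \<open>s\<close> to itself or to its negative, then \<open>n\<close> would
  divide \<open>2 * s\<close>, although \<open>0 < 2 * s < n\<close> because \<open>n\<close> is
  odd.\<close>

lemma card_coset_m2:
  assumes t: "t = 0" and s: "s \<in> MinRep q n" "s > 0"
  shows "card (cyc_coset q n s) = 2 * m"
proof -
  have m: "m = 2" using t m_eq by simp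
  have n2: "int n = Q\<^sup>2 + 1" by (simp add: n_def m)
  have L: "int s \<le> \<bar>int s * Q ^ i - k * int n\<bar>" for i k
    using MinRep_imp_int_leader[OF s(1)] by (simp add: int_leader_def)
  have sn: "s < n" using s by (simp add: MinRep_def)
  then have "2 * s \<le> n" using L[of 0 1] by simp
  moreover have "2 * s \<noteq> n" using odd_n by (metis dvd_triv_left)
  ultimately have two: "2 * s < n" by simp
  have neg: "[int s * Q ^ m = - int s] (mod int n)"
    using cong_scalar_left[OF q_pow_m, of "int s"] by simp
  have inner: "\<exists>e r. (e = 1 \<or> e = - 1) \<and> int s < r \<and> r < int n - int s \<and>
        [int s * Q ^ i = e * r] (mod int n)" if "0 < i" "i < m" for i
  proof -
    have i: "i = 1" using that m by simp
    define k where "k = (int s * Q) div int n"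
    define r where "r = (int s * Q) mod int n"
    have r: "int s * Q = k * int n + r" by (simp add: r_def k_def)
    have r0: "0 \<le> r" "r < int n" using n_gt_2 by (simp_all add: r_def)
    have "int s \<le> r" using L[of 1 k] r r0 by simp
    moreover have "int s \<le> int n - r" using L[of 1 "k + 1"] r r0 by (simp add: algebra_simps)
    moreover have "\<not> int n dvd 2 * int s" using two s zdvd_imp_le[of "int n" "2 * int s"] by auto
    have "r \<noteq> int s"
    proof
      assume "r = int s"
      then have "int s * Q - int s = k * int n" using r by simp
      \<comment> \<open>The factor turns \<open>Q - 1\<close> into \<open>Q ^ 2 - 1 = n - 2\<close>;
        the factor \<open>Q - 1\<close> does the same for \<open>Q + 1\<close> in the other
        case.\<close>
      then have "(Q + 1) * (int s * Q - int s) = (Q + 1) * (k * int n)" by simp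
      then have "2 * int s = int n * (int s - (Q + 1) * k)"
        by (simp add: n2 algebra_simps power2_eq_square)
      then show False using \<open>\<not> int n dvd 2 * int s\<close> by simp
    qed
    moreover have "r \<noteq> int n - int s"
    proof
      assume "r = int n - int s"
      then have "int s * Q + int s = (k + 1) * int n" using r by (simp add: algebra_simps)
      then have "(Q - 1) * (int s * Q + int s) = (Q - 1) * ((k + 1) * int n)" by simp
      then have "2 * int s = int n * (int s - (Q - 1) * (k + 1))"
        by (simp add: n2 algebra_simps power2_eq_square)
      then show False using \<open>\<not> int n dvd 2 * int s\<close> by simp
    qed
    moreover have "[int s * Q ^ i = 1 * r] (mod int n)" using i by (simp add: r_def)
    ultimately show ?thesis by (intro exI[of _ 1] exI[of _ r]) simp
  qed
  show ?thesis using leaderI(2)[OF s(2) two m_pos neg inner] .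
qed

text \<open>For positive \<open>t\<close> the second leader is identified as
  \<open>s2 = s1 - u2\<close>: \<open>second_leader_residues\<close> shows that \<open>s2\<close> is
  a leader, and \<open>int_leader_gap\<close> that no leader lies strictly between \<open>s2\<close>
  and \<open>s1\<close>.\<close>

lemma card_coset_delta_rep_2:
  assumes pos: "delta_rep q n 2 > 0"
  shows "card (cyc_coset q n (delta_rep q n 2)) = 2 * m"
proof (cases t)
  case 0
  then show ?thesis using card_coset_m2 pos delta_rep_2_props(1) by blast
next
  case (Suc t')
  define M where "M = alt_quot Q t'"
  have M: "M \<ge> 1" "(Q\<^sup>2 + 1) * M = Q ^ (4 * t' + 2) + 1"
    using alt_quot_pos[of Q t'] Q_ge2 alt_quot_mult by (simp_all add: M_def)
  have N: "N = Q ^ 4 * M - Q\<^sup>2 + 1" by (simp add: Suc M_def)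
  define u2 where "u2 = Q * (Q - 1) * M"
  define s2 where "s2 = s1 - u2"
  have s2_eq: "s2 = s1 - Q * (Q - 1) * M" by (simp only: s2_def u2_def)
  have u2_pos: "u2 > 0" unfolding u2_def using Q_ge2 M by (intro mult_pos_pos) simp_all
  have s2_pos: "s2 > 0"
  proof -
    have Q2: "Q\<^sup>2 \<ge> 4" using power_mono[OF Q_ge2, of 2] by simp
    have "Q\<^sup>2 * (Q\<^sup>2 * M) \<ge> 4 * (Q\<^sup>2 * M)" using Q2 M by (intro mult_right_mono) simp_all
    moreover have "Q\<^sup>2 * M \<ge> 4 * M" using Q2 M by (intro mult_right_mono) simp_all
    moreover have "Q\<^sup>2 * M \<ge> Q\<^sup>2 * 1" using M by (intro mult_left_mono) simp_all
    moreover have "Q ^ 4 * M = Q\<^sup>2 * (Q\<^sup>2 * M)" by (simp add: power4_eq_xxxx power2_eq_square)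
    ultimately have "N - 2 * M > 0" using N M Q2 by linarith
    then have "Q * (Q - 1) * (N - 2 * M) > 0" using Q_ge2 by (intro mult_pos_pos) simp_all
    moreover have "2 * s2 = Q * (Q - 1) * (N - 2 * M)"
      unfolding s2_def u2_def right_diff_distrib two_s1 by (simp add: algebra_simps)
    ultimately show ?thesis by linarith
  qed
  have two: "2 * s2 < int n"
    using two_s1_less u2_pos unfolding s2_def right_diff_distrib by linarith
  have int_s2: "int (nat s2) = s2" using s2_pos by simp
  have neg: "[int (nat s2) * Q ^ m = - int (nat s2)] (mod int n)"
    using cong_scalar_left[OF q_pow_m, of "int (nat s2)"] by simp
  have inner: "\<exists>e r. (e = 1 \<or> e = - 1) \<and> int (nat s2) < r \<and> r < int n - int (nat s2) \<and>
        [int (nat s2) * Q ^ i = e * r] (mod int n)" if "0 < i" "i < m" for i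
    unfolding int_s2
    by (rule second_leader_residues[OF Q_eq P_pos n_eq N M s1_def s2_eq that(1) that(2)[unfolded m_eq Suc]])
  have leader: "nat s2 \<in> MinRep q n" "card (cyc_coset q n (nat s2)) = 2 * m"
    using leaderI[of "nat s2" m, OF _ _ m_pos neg inner] s2_pos two by simp_all
  have "delta_rep q n 2 = nat s2"
  proof (rule antisym)
    show "nat s2 \<le> delta_rep q n 2"
      using leader(1) u2_pos s2_pos by (intro delta_rep_2_props(3)) (auto simp: delta_rep_1_eq[unfolded One_nat_def] s2_def)
    define s where "s = delta_rep q n 2"
    define u where "u = s1 - int s"
    have "int s < s1" using delta_rep_2_props(2) s1_pos by (simp add: s_def delta_rep_1_eq[unfolded One_nat_def])
    then have u_pos: "u > 0" by (simp add: u_def)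
    have s_eq: "int s = P * (Q - 1) * N - u" by (simp add: u_def s1_def)
    have negs: "[int s * Q ^ (4 * t + 2) = - int s] (mod int n)"
      using cong_scalar_left[OF q_pow_m, of "int s"] by (simp add: m_eq)
    have "int s > 0" using pos by (simp add: s_def)
    then have ge: "Q ^ 4 * u \<ge> 2 * s1" unfolding s1_def
      by (rule int_leader_gap[OF Q_eq P_pos n_eq N_pos
            MinRep_imp_int_leader[OF delta_rep_2_props(1), folded s_def] _ s_eq u_pos negs])
    \<comment> \<open>\<open>Q ^ 4 * u2\<close> exceeds \<open>2 * s1\<close> by less than
      \<open>Q ^ 4\<close>, so \<open>u2\<close> is the least integer that meets the bound
      \<open>ge\<close>.\<close>
    have "u \<ge> u2"
    proof (rule ccontr)
      assume "\<not> u \<ge> u2"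
      then have "Q ^ 4 * u \<le> Q ^ 4 * (u2 - 1)" using Q_ge2 by (intro mult_left_mono) simp_all
      moreover have "Q ^ 4 * u2 = 2 * s1 + Q * (Q - 1) * (Q\<^sup>2 - 1)"
        unfolding two_s1 u2_def N by (simp add: algebra_simps power4_eq_xxxx power2_eq_square)
      moreover have "Q * (Q - 1) * (Q\<^sup>2 - 1) < Q ^ 4"
      proof -
        have "0 < Q * (Q * Q)" "Q < Q * Q" using Q_ge2 by simp_all
        then show ?thesis by (simp add: algebra_simps power4_eq_xxxx power2_eq_square)
      qed
      ultimately show False using ge by (simp add: algebra_simps)
    qed
    then show "delta_rep q n 2 \<le> nat s2" by (simp add: s_def u_def s2_def)
  qed
  then show ?thesis using leader by simp
qed

end


section \<open>BCH codes of length \<open>q ^ m + 1\<close>\<close>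

locale antipodal_bch = cyclic_code_field emb \<beta> n q + antipodal_modulus_2mod4 q m n t
  for emb :: "'a::{field,finite} \<Rightarrow> 'b::{field,finite}" and \<beta> q m n t
begin

lemma mem_zset_iff: "x \<in> zset I \<longleftrightarrow> (\<exists>i\<in>I. x \<in> cyc_coset q n i)"
  by (auto simp: zset_def cyc_coset_eq)

text \<open>The leader of an exponent in the interval is at most that exponent, but it could drop
  below a general \<open>b\<close>. For \<open>b \<le> 1\<close> it cannot, since only 0 has leader
  0.\<close>

lemma zset_interval:
  assumes d: "d < n" and b: "b \<le> 1"
  shows "zset {b..d} = {x. x < n \<and> b \<le> coset_leader x \<and> coset_leader x \<le> d}"
proof (intro equalityI subsetI)
  fix x assume "x \<in> zset {b..d}"
  then obtain i where i: "b \<le> i" "i \<le> d" "x \<in> cyc_coset q n i" by (auto simp: mem_zset_iff)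
  have "i < n" using i d by simp
  then have ld: "coset_leader x = coset_leader i" using i by (intro coset_leader_eq)
  have "coset_leader i \<le> i"
    unfolding coset_leader_def using \<open>i < n\<close>
    by (intro Min_le finite_cyc_coset mem_cyc_coset_self)
  moreover have "b \<le> coset_leader i"
    using coset_leader_eq_0_iff[OF \<open>i < n\<close>] b i by (cases "coset_leader i = 0") auto
  ultimately show "x \<in> {x. x < n \<and> b \<le> coset_leader x \<and> coset_leader x \<le> d}"
    using i ld cyc_coset_less by auto
next
  fix x assume x: "x \<in> {x. x < n \<and> b \<le> coset_leader x \<and> coset_leader x \<le> d}"
  then have "x \<in> cyc_coset q n (coset_leader x)"
    using cyc_coset_MinRep[OF coset_leader_in_MinRep] by simp
  then show "x \<in> zset {b..d}" using x by (auto simp: mem_zset_iff)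
qed

text \<open>The complement of the defining set consists of the cosets with leader above
  \<open>d\<close> and, for \<open>b = 1\<close>, the exponent 0.\<close>

lemma card_zset_interval:
  assumes d: "d < n" and b: "b \<le> 1"
  shows "n - card (zset {b..d}) = b + (\<Sum>l | l \<in> MinRep q n \<and> d < l. card (cyc_coset q n l))"
proof (cases "b \<le> d")
  case bd: True
  let ?L = "{l. l \<in> MinRep q n \<and> d < l}"
  have fin: "finite ?L" using finite_MinRep by simp
  have sub: "zset {b..d} \<subseteq> {..<n}" using q_closed_zset by (simp add: q_closed_def)
  then have "n - card (zset {b..d}) = card ({..<n} - zset {b..d})"
    by (simp add: card_Diff_subset finite_subset)
  also have "{..<n} - zset {b..d} = {x. x < n \<and> coset_leader x < b} \<union> (\<Union>l\<in>?L. cyc_coset q n l)"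
  proof -
    have "(\<Union>l\<in>?L. cyc_coset q n l) = {x. x < n \<and> d < coset_leader x}"
      using cyc_coset_MinRep coset_leader_in_MinRep by auto
    then show ?thesis unfolding zset_interval[OF d b] by auto
  qed
  also have "card \<dots> = card {x. x < n \<and> coset_leader x < b} + card (\<Union>l\<in>?L. cyc_coset q n l)"
    using bd by (intro card_Un_disjoint) (auto simp: fin finite_cyc_coset cyc_coset_MinRep)
  also have "{x. x < n \<and> coset_leader x < b} = {..<b}"
    using b n_gt_2 coset_leader_eq_0_iff by (cases b) auto
  also have "card (\<Union>l\<in>?L. cyc_coset q n l) = (\<Sum>l\<in>?L. card (cyc_coset q n l))"
    using fin by (intro card_UN_disjoint) (auto simp: finite_cyc_coset cyc_coset_MinRep)
  finally show ?thesis by simp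
next
  case False
  \<comment> \<open>The empty interval, which arises for \<delta> = 1; the code is then the whole
    space.\<close>
  then have bd: "b = 1" "d = 0" using b by auto
  have "(\<Sum>l | l \<in> MinRep q n \<and> 0 < l. card (cyc_coset q n l)) = card (\<Union>l\<in>{l \<in> MinRep q n. 0 < l}. cyc_coset q n l)"
    using finite_MinRep by (intro card_UN_disjoint[symmetric]) (auto simp: finite_cyc_coset cyc_coset_MinRep)
  also have "(\<Union>l\<in>{l \<in> MinRep q n. 0 < l}. cyc_coset q n l) = {1..<n}"
    using cyc_coset_MinRep coset_leader_in_MinRep coset_leader_eq_0_iff by fastforce
  finally show ?thesis using n_gt_2 by (simp add: bd zset_def)
qed

lemma zset_neg:
  assumes z: "z \<in> zset I"
  shows "(n - z) mod n \<in> zset I"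
proof -
  obtain i k where ik: "z = i * q ^ k mod n" "i \<in> I" using z by (auto simp: zset_def)
  have zn: "z < n" using ik n_gt_2 by simp
  have "[int (i * q ^ (k + m) mod n) = - int (i * q ^ k)] (mod int n)" by (rule neg_residue)
  also have "[- int (i * q ^ k) = int (n - z)] (mod int n)"
  proof -
    have "[int z = int (i * q ^ k)] (mod int n)" unfolding cong_int_iff by (simp add: ik cong_def)
    then have "int n dvd (int z - int (i * q ^ k)) - int n" by (simp add: cong_iff_dvd_diff)
    also have "(int z - int (i * q ^ k)) - int n = - int (i * q ^ k) - int (n - z)"
      using zn by (simp add: of_nat_diff)
    finally show ?thesis by (simp only: cong_iff_dvd_diff)
  qed
  finally have "[i * q ^ (k + m) mod n = n - z] (mod n)" by (simp only: cong_int_iff)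
  then have "(n - z) mod n = i * q ^ (k + m) mod n" by (simp add: cong_def)
  then show ?thesis using ik(2) unfolding zset_def by blast
qed

lemma zset_code_params:
  assumes d: "d < n" and b: "b \<le> 1"
    and wt: "\<And>c. c \<in> zero_code (zset {b..d}) \<Longrightarrow> c \<noteq> 0 \<Longrightarrow> D \<le> hweight c"
  shows "is_LCD n (zero_code (zset {b..d})) \<and> code_params n (zero_code (zset {b..d}))
    (b + (\<Sum>l | l \<in> MinRep q n \<and> d < l. card (cyc_coset q n l))) D"
proof
  show "is_LCD n (zero_code (zset {b..d}))"
    by (rule is_LCD_zero_code[OF q_closed_zset coprime_q_n zset_neg])
  show "code_params n (zero_code (zset {b..d}))
    (b + (\<Sum>l | l \<in> MinRep q n \<and> d < l. card (cyc_coset q n l))) D"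
    unfolding code_params_def
    using wt subspace_zero_code dim_zero_code[OF q_closed_zset coprime_q_n] card_zset_interval[OF d b]
    by (auto simp: zero_code_def)
qed

text \<open>Zeros at the exponents from 1 to \<open>\<delta> - 1\<close> give weight at least
  \<delta>. The dimension depends only on the leaders from \<delta> upwards, and \<open>D\<close> is
  left free so that the next smaller leader can be inserted.\<close>

lemma bch_code_1_params:
  assumes \<delta>: "1 \<le> \<delta>" "\<delta> \<le> n" and D: "D \<le> \<delta>"
  shows "is_LCD n (bch_code emb \<beta> n \<delta> 1) \<and> code_params n (bch_code emb \<beta> n \<delta> 1)
    (1 + (\<Sum>l | l \<in> MinRep q n \<and> \<delta> \<le> l. card (cyc_coset q n l))) D"
proof -
  have eq: "bch_code emb \<beta> n \<delta> 1 = zero_code (zset {1..\<delta> - 1})"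
    unfolding bch_code_eq_zero_code[OF coprime_q_n] by simp
  have wt: "D \<le> hweight c" if c: "c \<in> zero_code (zset {1..\<delta> - 1})" "c \<noteq> 0" for c
  proof -
    have "poly (epoly c) (\<beta> ^ (1 + k)) = 0" if "k < \<delta> - 1" for k
    proof -
      have "\<forall>i\<in>{1..\<delta> - 1}. poly (epoly c) (\<beta> ^ i) = 0"
        using c(1) zero_on_zset_iff[of "{1..\<delta> - 1}" c] by (auto simp only: zero_code_def mem_Collect_eq)
      then show ?thesis by (rule bspec) (use that in simp)
    qed
    then have "\<delta> - 1 < hweight c"
      using c by (intro bch_bound[of c _ 1]) (auto simp: zero_code_def)
    then show ?thesis using D by simp
  qed
  have "{l. l \<in> MinRep q n \<and> \<delta> - 1 < l} = {l. l \<in> MinRep q n \<and> \<delta> \<le> l}" using \<delta> by auto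
  then show ?thesis
    using zset_code_params[of "\<delta> - 1" 1, OF _ _ wt] \<delta> n_gt_2 unfolding eq by simp
qed

lemma bch_code_0_params:
  assumes \<delta>: "1 \<le> \<delta>" "\<delta> \<le> n" and D: "D \<le> 2 * \<delta>"
  shows "is_LCD n (bch_code emb \<beta> n (\<delta> + 1) 0) \<and> code_params n (bch_code emb \<beta> n (\<delta> + 1) 0)
    (\<Sum>l | l \<in> MinRep q n \<and> \<delta> \<le> l. card (cyc_coset q n l)) D"
proof -
  have eq: "bch_code emb \<beta> n (\<delta> + 1) 0 = zero_code (zset {0..\<delta> - 1})"
    unfolding bch_code_eq_zero_code[OF coprime_q_n] by simp
  have wt: "D \<le> hweight c" if c: "c \<in> zero_code (zset {0..\<delta> - 1})" "c \<noteq> 0" for c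
  proof -
    have zeros: "poly (epoly c) (\<beta> ^ j) = 0" if "j \<le> \<delta> - 1" for j
      using c that zero_on_zset_iff[of "{0..\<delta> - 1}" c] by (simp add: zero_code_def)
    \<comment> \<open>With 0 included, closure under negation gives a run from
      \<open>- (\<delta> - 1)\<close> to \<open>\<delta> - 1\<close>, of length
      \<open>2 * \<delta> - 1\<close>; the shift by \<open>n\<close> keeps the exponents natural
      numbers.\<close>
    have "poly (epoly c) (\<beta> ^ (n - (\<delta> - 1) + k)) = 0" if k: "k < 2 * \<delta> - 1" for k
    proof (cases "\<delta> - 1 \<le> k")
      case True
      then have "n - (\<delta> - 1) + k = n + (k - (\<delta> - 1))" using \<delta> by simp
      then have "\<beta> ^ (n - (\<delta> - 1) + k) = \<beta> ^ (k - (\<delta> - 1))"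
        using beta_power_eq_1_iff[of n] by (simp only: power_add) simp
      then show ?thesis using zeros[of "k - (\<delta> - 1)"] k by simp
    next
      case False
      define j where "j = \<delta> - 1 - k"
      have j: "0 < j" "j \<le> \<delta> - 1" "j < n" "n - (\<delta> - 1) + k = n - j" using False \<delta> by (auto simp: j_def)
      have "j * q ^ 0 mod n \<in> zset {0..\<delta> - 1}" unfolding zset_def using j by fastforce
      then have "j \<in> zset {0..\<delta> - 1}" using j by simp
      then have "(n - j) mod n \<in> zset {0..\<delta> - 1}" by (rule zset_neg)
      then have "n - j \<in> zset {0..\<delta> - 1}" using j by simp
      then show ?thesis using c(1) j(4) by (simp add: zero_code_def)
    qed
    then have "2 * \<delta> - 1 < hweight c"
      using c by (intro bch_bound[of c _ "n - (\<delta> - 1)"]) (auto simp: zero_code_def)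
    then show ?thesis using D by simp
  qed
  have "{l. l \<in> MinRep q n \<and> \<delta> - 1 < l} = {l. l \<in> MinRep q n \<and> \<delta> \<le> l}" using \<delta> by auto
  then show ?thesis
    using zset_code_params[of "\<delta> - 1" 0, OF _ _ wt] \<delta> n_gt_2 unfolding eq by simp
qed

lemma delta_rep_1_le_n: "delta_rep q n 1 \<le> n"
  using first_leader(1) unfolding delta_rep_1_eq by (simp add: MinRep_def)

lemma leader_sum_1:
  assumes "delta_rep q n 2 < \<delta>" "\<delta> \<le> delta_rep q n 1"
  shows "(\<Sum>l | l \<in> MinRep q n \<and> \<delta> \<le> l. card (cyc_coset q n l)) = 4"
proof -
  have "{l. l \<in> MinRep q n \<and> \<delta> \<le> l} = {delta_rep q n 1}"
    using assms delta_rep_2_props(3) first_leader(1) unfolding delta_rep_1_eq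
    by (fastforce dest: leD)
  then show ?thesis using first_leader(2) by (simp add: delta_rep_1_eq[unfolded One_nat_def])
qed

lemma leader_sum_2:
  assumes "delta_rep q n 3 < \<delta>" "\<delta> \<le> delta_rep q n 2"
  shows "(\<Sum>l | l \<in> MinRep q n \<and> \<delta> \<le> l. card (cyc_coset q n l)) = 2 * m + 4"
proof -
  have lt: "delta_rep q n 3 < delta_rep q n 2" using assms by simp
  have "{l. l \<in> MinRep q n \<and> \<delta> \<le> l} = {delta_rep q n 1, delta_rep q n 2}"
  proof (intro equalityI subsetI)
    fix l assume "l \<in> {l. l \<in> MinRep q n \<and> \<delta> \<le> l}"
    then show "l \<in> {delta_rep q n 1, delta_rep q n 2}"
      using delta_rep_3_props[OF lt, of l] assms by auto
  next
    fix l assume "l \<in> {delta_rep q n 1, delta_rep q n 2}"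
    then show "l \<in> {l. l \<in> MinRep q n \<and> \<delta> \<le> l}"
      using delta_rep_2_props(1,2) assms first_leader(1) by (auto simp: delta_rep_1_eq[unfolded One_nat_def])
  qed
  moreover have "delta_rep q n 1 \<noteq> delta_rep q n 2" using delta_rep_2_props(2) by simp
  moreover have "card (cyc_coset q n (delta_rep q n 2)) = 2 * m"
    using lt by (intro card_coset_delta_rep_2) simp
  moreover have "card (cyc_coset q n (delta_rep q n 1)) = 4"
    using first_leader(2) by (simp only: delta_rep_1_eq)
  ultimately show ?thesis by simp
qed

end

section \<open>Characteristic two and the given generator of the extension field\<close>

lemma frobenius_add_power_of_2:
  fixes x y :: "'b::{field,finite}"
  assumes "card (UNIV :: 'b set) = 2 ^ k" "q = 2 ^ s"
  shows "(x + y) ^ q = x ^ q + y ^ q"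
proof -
  have "CHAR('b) > 0" by (rule finite_imp_CHAR_pos) simp
  then have prime: "prime CHAR('b)" by (rule prime_CHAR_semidom)
  have "CHAR('b) dvd 2 ^ k" using CHAR_dvd_CARD[where ?'a = 'b] assms by simp
  then have "CHAR('b) dvd 2" using prime prime_dvd_power by blast
  then have "CHAR('b) = 2" using prime primes_dvd_imp_eq two_is_prime_nat by blast
  then show ?thesis using freshmans_dream'[OF prime, of q s] assms by simp
qed

theorem theorem1:
  fixes emb :: "'a::{field,finite} \<Rightarrow> 'b::{field,finite}"
    and \<alpha> :: 'b and q m t n :: nat
  assumes q_pow2: "\<exists>s\<ge>1. q = 2 ^ s"
    and card_a: "card (UNIV :: 'a set) = q"
    and m_def: "m = 4 * t + 2"
    and n_def: "n = q ^ m + 1"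
    and card_b: "card (UNIV :: 'b set) = q ^ ord n q"
    and emb_one: "emb 1 = 1"
    and emb_add: "\<forall>x y. emb (x + y) = emb x + emb y"
    and emb_mult: "\<forall>x y. emb (x * y) = emb x * emb y"
    and \<alpha>_gen: "\<forall>y::'b. y \<noteq> 0 \<longrightarrow> (\<exists>k. y = \<alpha> ^ k)"
  defines "\<beta> \<equiv> \<alpha> ^ ((q ^ ord n q - 1) div n)"
  shows
    "(\<forall>\<delta>. delta_rep q n 2 + 1 \<le> \<delta> \<and> \<delta> \<le> delta_rep q n 1 \<longrightarrow>
        is_LCD n (bch_code emb \<beta> n \<delta> 1) \<and>
        code_params n (bch_code emb \<beta> n \<delta> 1) 5 (delta_rep q n 2))
   \<and> (\<forall>\<delta>. delta_rep q n 3 + 1 \<le> \<delta> \<and> \<delta> \<le> delta_rep q n 2 \<longrightarrow>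
        is_LCD n (bch_code emb \<beta> n \<delta> 1) \<and>
        code_params n (bch_code emb \<beta> n \<delta> 1) (2 * m + 5) (delta_rep q n 3))
   \<and> (\<forall>\<delta>. delta_rep q n 2 + 1 \<le> \<delta> \<and> \<delta> \<le> delta_rep q n 1 \<longrightarrow>
        is_LCD n (bch_code emb \<beta> n (\<delta> + 1) 0) \<and>
        code_params n (bch_code emb \<beta> n (\<delta> + 1) 0) 4 (2 * delta_rep q n 2))
   \<and> (\<forall>\<delta>. delta_rep q n 3 + 1 \<le> \<delta> \<and> \<delta> \<le> delta_rep q n 2 \<longrightarrow>
        is_LCD n (bch_code emb \<beta> n (\<delta> + 1) 0) \<and>
        code_params n (bch_code emb \<beta> n (\<delta> + 1) 0) (2 * m + 4) (2 * delta_rep q n 3))"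
proof -
  obtain s where s: "s \<ge> 1" "q = 2 ^ s" using q_pow2 by blast
  have "even q" using s by simp
  moreover have "q \<ge> 2" using s power_increasing[of 1 s "2::nat"] by simp
  \<comment> \<open>The arithmetic of \<open>n\<close> is needed first: it gives
    \<open>ord n q = 2 * m\<close> and thus the size of the extension, on which the order of \<beta>
    depends.\<close>
  ultimately interpret M: antipodal_modulus_2mod4 q m n t
    using n_def m_def by unfold_locales simp_all
  define Q where "Q = q ^ (2 * m)"
  have card_Q: "card (UNIV :: 'b set) = Q" using card_b M.ord_eq by (simp add: Q_def)
  have "Q = q ^ m * q ^ m" by (simp add: Q_def mult_2 flip: power_add)
  \<comment> \<open>Difference of squares: \<open>Q - 1\<close> is the product of
    \<open>q ^ m - 1\<close> and \<open>q ^ m + 1\<close>, so the division by \<open>n\<close> in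
    the exponent of \<beta> is exact.\<close>
  then have "Q = (q ^ m - 1) * n + 1"
    using \<open>q \<ge> 2\<close> by (cases "q ^ m") (auto simp: n_def algebra_simps)
  then have dvd: "n dvd Q - 1" by simp
  have "Q \<ge> q ^ 2" unfolding Q_def using \<open>q \<ge> 2\<close> m_def by (intro power_increasing) simp_all
  then have Q2: "Q > 2" using power_mono[OF \<open>q \<ge> 2\<close>, of 2] by simp
  have \<beta>_eq: "\<beta> = \<alpha> ^ ((Q - 1) div n)" by (simp add: \<beta>_def Q_def M.ord_eq)
  have order: "\<beta> ^ k = 1 \<longleftrightarrow> n dvd k" for k
  proof -
    define c where "c = (Q - 1) div n"
    have c: "Q - 1 = c * n" using dvd by (simp add: c_def)
    then have "c > 0" using Q2 by (cases c) auto
    have "\<beta> ^ k = 1 \<longleftrightarrow> \<alpha> ^ (c * k) = 1" by (simp add: \<beta>_eq c_def power_mult)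
    also have "\<dots> \<longleftrightarrow> Q - 1 dvd c * k"
      using generator_power_eq_1_iff[OF \<alpha>_gen] card_Q Q2 by simp
    also have "\<dots> \<longleftrightarrow> n dvd k" unfolding c using \<open>c > 0\<close> by simp
    finally show ?thesis .
  qed
  interpret antipodal_bch emb \<beta> q m n t
  proof unfold_locales
    show "(x + y :: 'b) ^ q = x ^ q + y ^ q" for x y
      by (rule frobenius_add_power_of_2[of "s * (2 * m)" q s]) (simp_all add: card_Q Q_def s power_mult)
  qed (use emb_one emb_add emb_mult card_a order M.n_gt_2 in auto)
  note bound = delta_rep_1_le_n M.delta_rep_2_props(2)
  show ?thesis
  proof (intro conjI allI impI)
    fix \<delta> assume \<delta>: "delta_rep q n 2 + 1 \<le> \<delta> \<and> \<delta> \<le> delta_rep q n 1"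
    then have sum: "(\<Sum>l | l \<in> MinRep q n \<and> \<delta> \<le> l. card (cyc_coset q n l)) = 4"
      by (intro leader_sum_1) simp_all
    have "1 \<le> \<delta>" "\<delta> \<le> n" using \<delta> bound by simp_all
    note p1 = bch_code_1_params[OF this, of "delta_rep q n 2"]
      and p0 = bch_code_0_params[OF this, of "2 * delta_rep q n 2"]
    show "is_LCD n (bch_code emb \<beta> n \<delta> 1)" "code_params n (bch_code emb \<beta> n \<delta> 1) 5 (delta_rep q n 2)"
      using p1 \<delta> sum by simp_all
    show "is_LCD n (bch_code emb \<beta> n (\<delta> + 1) 0)"
      "code_params n (bch_code emb \<beta> n (\<delta> + 1) 0) 4 (2 * delta_rep q n 2)"
      using p0 \<delta> sum by simp_all
  next
    fix \<delta> assume \<delta>: "delta_rep q n 3 + 1 \<le> \<delta> \<and> \<delta> \<le> delta_rep q n 2"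
    then have sum: "(\<Sum>l | l \<in> MinRep q n \<and> \<delta> \<le> l. card (cyc_coset q n l)) = 2 * m + 4"
      by (intro leader_sum_2) simp_all
    have "1 \<le> \<delta>" "\<delta> \<le> n" using \<delta> bound by simp_all
    note p1 = bch_code_1_params[OF this, of "delta_rep q n 3"]
      and p0 = bch_code_0_params[OF this, of "2 * delta_rep q n 3"]
    show "is_LCD n (bch_code emb \<beta> n \<delta> 1)"
      "code_params n (bch_code emb \<beta> n \<delta> 1) (2 * m + 5) (delta_rep q n 3)"
      using p1 \<delta> sum by (simp_all add: add.commute)
    show "is_LCD n (bch_code emb \<beta> n (\<delta> + 1) 0)"
      "code_params n (bch_code emb \<beta> n (\<delta> + 1) 0) (2 * m + 4) (2 * delta_rep q n 3)"
      using p0 \<delta> sum by simp_all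
  qed
qed

end
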